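(* Let $\mathcal{A}$ be a finite alphabet, let $(p_t)_{t\ge 1}$ be a strictly increasing sequence of positive integers with $p_t \mid p_{t+1}$ for all $t$, and let $\mathcal{G}_p$ be the family of all generalized Oxtoby subshifts $X\subseteq \mathcal{A}^{\mathbb{Z}}$ with respect to $(p_t)_{t\ge1}$. Then the conjugacy (isomorphism) relation on $\mathcal{G}_p$ is hyperfinite.
   Context: For a finite set $\mathcal{A}$, $S:\mathcal{A}^{\mathbb{Z}}\to\mathcal{A}^{\mathbb{Z}}$ denotes the shift map; a subshift is a closed set $X\subseteq\mathcal{A}^{\mathbb{Z}}$ with $SX=X$. Two subshifts $X,Y$ are conjugate (isomorphic) if there is a homeomorphism $X\to Y$ commuting with $S$. Subshifts are viewed as points of the space $K(\mathcal{A}^{\mathbb{Z}})$ of compact subsets of $\mathcal{A}^{\mathbb{Z}}$ with the Vietoris topology, and families of subshifts carry the Borel structure inherited from it. For $x\in\mathcal{A}^{\mathbb{Z}}$ and an integer $p\ge 1$, $\mathrm{Per}_p(x)=\{i\in\mathbb{Z}: x(i)=x(i+kp)\text{ for all }k\in\mathbb{Z}\}$; an $i\notin \mathrm{Per}_p(x)$ is called a $p$-hole of $x$. A Toeplitz sequence is an $x\in\mathcal{A}^{\mathbb{Z}}$ such that every $i\in\mathbb{Z}$ lies in $\mathrm{Per}_n(x)$ for some $n\ge1$. A period structure for a Toeplitz sequence $x$ is a strictly increasing sequence of integers $(p_t)_{t\ge0}$ with $p_0=1$, $p_t\mid p_{t+1}$ for all $t$, and $\bigcup_{t\ge1}\mathrm{Per}_{p_t}(x)=\mathbb{Z}$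 (the term $p_0=1$ is often omitted). A Toeplitz sequence $x$ with period structure $(p_t)_{t\ge1}$ is a generalized Oxtoby sequence with respect to $(p_t)_{t\ge1}$ if for each $t\ge1$ and $k\in\mathbb{Z}$: whenever the interval $[kp_t,(k+1)p_t)$ contains a $p_{t+1}$-hole of $x$, all $p_t$-holes of $x$ in this interval are $p_{t+1}$-holes of $x$. A generalized Oxtoby subshift with respect to $(p_t)_{t\ge1}$ is a subshift of the form $\overline{\mathcal{O}(x)}$ (orbit closure under $S$) for such an $x$. A countable Borel equivalence relation (one with all classes countable) is hyperfinite if it is an increasing union of a sequence of finite Borel equivalence relations, i.e. Borel equivalence relations with all classes finite. *)

theory Defs
  imports "HOL-Analysis.Analysis"
begin

section \<open>Subshifts and conjugacy\<close>

definition full_shift :: "'a set \<Rightarrow> (int \<Rightarrow> 'a) topology" where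
  "full_shift A = product_topology (\<lambda>_. discrete_topology A) UNIV"

definition shift :: "(int \<Rightarrow> 'a) \<Rightarrow> (int \<Rightarrow> 'a)" where
  "shift x = (\<lambda>i. x (i + 1))"

definition subshift :: "'a set \<Rightarrow> (int \<Rightarrow> 'a) set \<Rightarrow> bool" where
  "subshift A X \<longleftrightarrow> closedin (full_shift A) X \<and> shift ` X = X"

definition conjugate :: "'a set \<Rightarrow> (int \<Rightarrow> 'a) set \<Rightarrow> (int \<Rightarrow> 'a) set \<Rightarrow> bool" where
  "conjugate A X Y \<longleftrightarrow>
     (\<exists>f. homeomorphic_map (subtopology (full_shift A) X) (subtopology (full_shift A) Y) f \<and>
          (\<forall>x\<in>X. f (shift x) = shift (f x)))"

text \<open>The orbit is two-sided: it consists of all integer powers of the shift applied to \<open>x\<close>.\<close>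

definition orbit :: "(int \<Rightarrow> 'a) \<Rightarrow> (int \<Rightarrow> 'a) set" where
  "orbit x = range (\<lambda>n::int. \<lambda>i. x (i + n))"

definition orbit_closure :: "'a set \<Rightarrow> (int \<Rightarrow> 'a) \<Rightarrow> (int \<Rightarrow> 'a) set" where
  "orbit_closure A x = full_shift A closure_of orbit x"


section \<open>Generalized Oxtoby subshifts\<close>

definition Per :: "nat \<Rightarrow> (int \<Rightarrow> 'a) \<Rightarrow> int set" where
  "Per p x = {i. \<forall>k::int. x i = x (i + k * int p)}"

definition toeplitz :: "'a set \<Rightarrow> (int \<Rightarrow> 'a) \<Rightarrow> bool" where
  "toeplitz A x \<longleftrightarrow> x \<in> topspace (full_shift A) \<and> (\<forall>i. \<exists>n\<ge>1. i \<in> Per n x)"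

text \<open>Sequences \<open>(p\<^sub>t)\<close> are indexed by \<open>t \<ge> 1\<close>; the value \<open>p 0\<close> is ignored everywhere, which
  matches the convention of omitting the trivial term \<open>p\<^sub>0 = 1\<close>. The degenerate case \<open>p 1 = 1\<close>
  is not excluded.\<close>

definition period_seq :: "(nat \<Rightarrow> nat) \<Rightarrow> bool" where
  "period_seq p \<longleftrightarrow> (\<forall>t\<ge>1. 0 < p t) \<and> (\<forall>t\<ge>1. p t < p (t + 1)) \<and> (\<forall>t\<ge>1. p t dvd p (t + 1))"

definition period_structure :: "(int \<Rightarrow> 'a) \<Rightarrow> (nat \<Rightarrow> nat) \<Rightarrow> bool" where
  "period_structure x p \<longleftrightarrow> period_seq p \<and> (\<Union>t\<in>{1..}. Per (p t) x) = UNIV"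

definition hole :: "nat \<Rightarrow> (int \<Rightarrow> 'a) \<Rightarrow> int \<Rightarrow> bool" where
  "hole p x i \<longleftrightarrow> i \<notin> Per p x"

definition generalized_oxtoby :: "'a set \<Rightarrow> (nat \<Rightarrow> nat) \<Rightarrow> (int \<Rightarrow> 'a) \<Rightarrow> bool" where
  "generalized_oxtoby A p x \<longleftrightarrow>
     toeplitz A x \<and> period_structure x p \<and>
     (\<forall>t\<ge>1. \<forall>k::int.
        (\<exists>i\<in>{k * int (p t) ..< (k + 1) * int (p t)}. hole (p (t + 1)) x i) \<longrightarrow>
        (\<forall>i\<in>{k * int (p t) ..< (k + 1) * int (p t)}. hole (p t) x i \<longrightarrow> hole (p (t + 1)) x i))"

definition oxtoby_subshifts :: "'a set \<Rightarrow> (nat \<Rightarrow> nat) \<Rightarrow> (int \<Rightarrow> 'a) set set" where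
  "oxtoby_subshifts A p =
     {X. subshift A X \<and> (\<exists>x. generalized_oxtoby A p x \<and> X = orbit_closure A x)}"

definition conjugacy_on :: "'a set \<Rightarrow> (int \<Rightarrow> 'a) set set \<Rightarrow> ((int \<Rightarrow> 'a) set \<times> (int \<Rightarrow> 'a) set) set" where
  "conjugacy_on A G = {(X, Y). X \<in> G \<and> Y \<in> G \<and> conjugate A X Y}"


section \<open>The Borel structure of families of subshifts\<close>

definition vietoris :: "'b topology \<Rightarrow> 'b set topology" where
  "vietoris T = topology_generated_by
     ({{K. compactin T K \<and> K \<subseteq> U} | U. openin T U} \<union>
      {{K. compactin T K \<and> K \<inter> U \<noteq> {}} | U. openin T U})"

text \<open>The library's \<^const>\<open>borel\<close> is tied to the topology of a type class, so the Borel
  sigma-algebra of an abstract topology is introduced here.\<close>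

definition borel_of :: "'b topology \<Rightarrow> 'b measure" where
  "borel_of T = sigma (topspace T) {U. openin T U}"

definition subshift_borel :: "'a set \<Rightarrow> (int \<Rightarrow> 'a) set set \<Rightarrow> (int \<Rightarrow> 'a) set measure" where
  "subshift_borel A G = restrict_space (borel_of (vietoris (full_shift A))) G"

lemma topspace_vietoris: "topspace (vietoris T) = {K. compactin T K}"
proof
  show "topspace (vietoris T) \<subseteq> {K. compactin T K}"
    unfolding vietoris_def topology_generated_by_topspace by auto
  show "{K. compactin T K} \<subseteq> topspace (vietoris T)"
  proof
    fix K assume "K \<in> {K. compactin T K}"
    then have K: "K \<in> {K. compactin T K \<and> K \<subseteq> topspace T}"
      by (simp add: compactin_subset_topspace)
    have "{K. compactin T K \<and> K \<subseteq> topspace T} \<in> {{K. compactin T K \<and> K \<subseteq> U} | U. openin T U}"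
      by (rule CollectI, rule exI[of _ "topspace T"]) simp
    from UnionI[OF UnI1[OF this] K] show "K \<in> topspace (vietoris T)"
      unfolding vietoris_def topology_generated_by_topspace .
  qed
qed

lemma space_borel_of: "space (borel_of T) = topspace T"
  unfolding borel_of_def by (rule space_measure_of) (auto dest: openin_subset)

lemma sets_borel_of: "sets (borel_of T) = sigma_sets (topspace T) {U. openin T U}"
  unfolding borel_of_def by (rule sets_measure_of) (auto dest: openin_subset)

lemma space_subshift_borel:
  assumes "finite A" and "\<And>X. X \<in> G \<Longrightarrow> subshift A X"
  shows "space (subshift_borel A G) = G"
proof -
  have "compact_space (full_shift A)"
    using assms(1) unfolding full_shift_def
    by (simp add: compact_space_product_topology compact_space_discrete_topology)
  then have "G \<subseteq> {K. compactin (full_shift A) K}"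
    using assms(2) closedin_compact_space unfolding subshift_def by blast
  then show ?thesis
    by (auto simp: subshift_borel_def space_borel_of space_restrict_space topspace_vietoris)
qed


section \<open>Hyperfinite equivalence relations\<close>

text \<open>\<open>M\<close> is only used as a measurable space; its measure is irrelevant.\<close>

definition borel_equiv :: "'b measure \<Rightarrow> ('b \<times> 'b) set \<Rightarrow> bool" where
  "borel_equiv M E \<longleftrightarrow> equiv (space M) E \<and> E \<in> sets (M \<Otimes>\<^sub>M M)"

definition countable_borel_equiv :: "'b measure \<Rightarrow> ('b \<times> 'b) set \<Rightarrow> bool" where
  "countable_borel_equiv M E \<longleftrightarrow> borel_equiv M E \<and> (\<forall>C \<in> space M // E. countable C)"

definition finite_borel_equiv :: "'b measure \<Rightarrow> ('b \<times> 'b) set \<Rightarrow> bool" where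
  "finite_borel_equiv M E \<longleftrightarrow> borel_equiv M E \<and> (\<forall>C \<in> space M // E. finite C)"

definition hyperfinite :: "'b measure \<Rightarrow> ('b \<times> 'b) set \<Rightarrow> bool" where
  "hyperfinite M E \<longleftrightarrow> countable_borel_equiv M E \<and>
     (\<exists>F :: nat \<Rightarrow> ('b \<times> 'b) set. (\<forall>n. finite_borel_equiv M (F n)) \<and> incseq F \<and> E = (\<Union>n. F n))"

end

theory Submission
  imports Defs
begin

text \<open>
  Consider the partition of \<open>\<int>\<close> into the intervals \<open>[k p\<^sub>s, (k + 1) p\<^sub>s)\<close>, and record for a point \<open>z\<close>
  only the equivalence relation ``\<open>z\<close> has equal blocks on the \<open>k\<close>-th and \<open>l\<close>-th interval''. Over a
  finite alphabet only finitely many points share this kernel, and a point determines its minimal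
  orbit closure. The Oxtoby condition at level \<open>s\<close> makes a cut of \<open>\<int>\<close> into such intervals
  essentially unique: if some but not all holes get filled at level \<open>s + 1\<close>, two admissible cuts
  lie in the same gap between \<open>p\<^sub>s\<close>-holes, hence lead to the same kernels. A conjugacy moves holes
  by a bounded distance only, whereas the cuts of an Oxtoby sequence have hole-free margins of
  unbounded length as \<open>s\<close> grows; so every conjugacy preserves the set of kernels of admissible cuts at
  all large levels. The conjugate pairs whose kernel sets agree at all levels \<open>s \<ge> n\<close> thus form an
  increasing sequence of finite equivalence relations exhausting conjugacy. Borelness holds since
  conjugacies are given by countably many block codes and since subshifts meeting a fixed
  \<open>F\<^sub>\<sigma>\<close> set form a Borel family.
\<close>

section \<open>Points of the full shift\<close>

text \<open>A conjugacy recodes blocks, so the blocks of a point of \<open>X\<close> cannot be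
  compared with those of its image. What survives is which blocks coincide, provided the recoding
  window meets only periodic positions beyond the block ends; this is where the hole-free margins
  enter. All good points are used at once: singling out one Oxtoby point would call for a Borel
  choice, whereas the set of kernels is read off from which F-sigma sets \<open>X\<close> meets.
  There are too many possible kernels to test one by one, so the level relations compare
  restrictions to finite squares; compactness then yields a point of \<open>Y\<close> with the whole
  kernel, and membership in \<open>Y\<close> is all that is asked of it. A step that fills no hole,
  or every hole, is compatible with every cut and says nothing about the right one; this explains
  the properness condition. If no level from some index on has good points, then the Oxtoby point is
  periodic. That case is settled directly, since every point with the period in question has the
  full kernel.\<close>

definition translate :: "int \<Rightarrow> (int \<Rightarrow> 'a) \<Rightarrow> int \<Rightarrow> 'a" where
  "translate n x = (\<lambda>i. x (i + n))"

definition agree :: "nat \<Rightarrow> (int \<Rightarrow> 'a) \<Rightarrow> (int \<Rightarrow> 'a) \<Rightarrow> bool" where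
  "agree N x y \<longleftrightarrow> (\<forall>i. \<bar>i\<bar> \<le> int N \<longrightarrow> x i = y i)"

lemma translate_apply: "translate n x i = x (i + n)"
  by (simp add: translate_def)

lemma translate_translate [simp]: "translate m (translate n x) = translate (m + n) x"
  by (simp add: translate_def add.assoc)

lemma translate_0 [simp]: "translate 0 x = x"
  by (simp add: translate_def)

lemma orbit_translate: "orbit x = range (\<lambda>n. translate n x)"
  by (simp add: orbit_def translate_def)

lemma agree_mono: "agree N x y \<Longrightarrow> M \<le> N \<Longrightarrow> agree M x y"
  by (auto simp: agree_def)

lemma topspace_full_shift: "x \<in> topspace (full_shift A) \<longleftrightarrow> (\<forall>i. x i \<in> A)"
  by (auto simp: full_shift_def PiE_def Pi_def)

lemma translate_in_topspace:
  "x \<in> topspace (full_shift A) \<Longrightarrow> translate n x \<in> topspace (full_shift A)"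
  by (simp add: topspace_full_shift translate_def)

lemma openin_full_shift_agree:
  assumes "openin (full_shift A) U" and "z \<in> U"
  shows "\<exists>N. \<forall>w\<in>topspace (full_shift A). agree N z w \<longrightarrow> w \<in> U"
proof -
  obtain V where fin: "finite {i. V i \<noteq> A}" and V: "z \<in> PiE UNIV V" "PiE UNIV V \<subseteq> U"
    using assms unfolding full_shift_def openin_product_topology_alt by force
  obtain N where N: "\<And>i. i \<in> {i. V i \<noteq> A} \<Longrightarrow> nat \<bar>i\<bar> \<le> N"
    using finite_imageI[OF fin, of "\<lambda>i. nat \<bar>i\<bar>"] by (metis (mono_tags, lifting) Max_ge imageI)
  have "w \<in> U" if w: "w \<in> topspace (full_shift A)" "agree N z w" for w
  proof -
    have "w i \<in> V i" for i
    proof (cases "V i = A")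
      case True
      then show ?thesis using w by (simp add: topspace_full_shift)
    next
      case False
      then have "w i = z i" using N[of i] w(2) by (simp add: agree_def)
      then show ?thesis using V(1) by auto
    qed
    then show ?thesis using V(2) by auto
  qed
  then show ?thesis by blast
qed

text \<open>The hypothesis makes \<open>Q\<close> depend only on the coordinates in
  \<open>[-N, N]\<close>, so the set contains the cylinder \<open>?T\<close> around each of its
  points. As \<open>agree\<close> is symmetric, the complement is of the same kind, and such sets
  are clopen.\<close>

lemma openin_full_shift_local:
  assumes "\<And>x y. agree N x y \<Longrightarrow> Q x \<Longrightarrow> Q y"
  shows "openin (full_shift A) {x \<in> topspace (full_shift A). Q x}"
proof (subst openin_subopen, intro ballI)
  fix x assume x: "x \<in> {x \<in> topspace (full_shift A). Q x}"
  let ?T = "PiE UNIV (\<lambda>i. if \<bar>i\<bar> \<le> int N then {x i} else A)"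
  have "finite {i. \<bar>i\<bar> \<le> int N}"
    by (rule finite_subset[of _ "{- int N..int N}"]) auto
  then have "openin (full_shift A) ?T"
    unfolding full_shift_def openin_PiE_gen using x
    by (auto simp: topspace_full_shift intro: finite_subset[rotated])
  moreover have "x \<in> ?T" using x by (auto simp: topspace_full_shift PiE_UNIV_domain)
  moreover have "?T \<subseteq> {x \<in> topspace (full_shift A). Q x}"
  proof
    fix y assume y: "y \<in> ?T"
    have *: "y i \<in> (if \<bar>i\<bar> \<le> int N then {x i} else A)" for i
      using y by blast
    have "y i \<in> A" for i
      using *[of i] x by (auto simp: topspace_full_shift split: if_splits)
    moreover have "agree N x y"
      unfolding agree_def using * by (metis singletonD)
    ultimately show "y \<in> {x \<in> topspace (full_shift A). Q x}"
      using assms x by (auto simp: topspace_full_shift)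
  qed
  ultimately show "\<exists>T. openin (full_shift A) T \<and> x \<in> T \<and> T \<subseteq> {x \<in> topspace (full_shift A). Q x}"
    by blast
qed

lemma agree_sym: "agree N x y \<Longrightarrow> agree N y x"
  by (simp add: agree_def)

lemma closedin_full_shift_local:
  assumes "\<And>x y. agree N x y \<Longrightarrow> Q x \<Longrightarrow> Q y"
  shows "closedin (full_shift A) {x \<in> topspace (full_shift A). Q x}"
proof -
  have "openin (full_shift A) {x \<in> topspace (full_shift A). \<not> Q x}"
    using assms agree_sym by (intro openin_full_shift_local[of N]) blast
  moreover have "topspace (full_shift A) - {x \<in> topspace (full_shift A). Q x} =
      {x \<in> topspace (full_shift A). \<not> Q x}" by auto
  ultimately show ?thesis by (simp add: closedin_def)
qed

lemma compact_space_full_shift: "finite A \<Longrightarrow> compact_space (full_shift A)"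
  by (simp add: full_shift_def compact_space_product_topology compact_space_discrete_topology)

section \<open>Orbit closures and shift invariance\<close>

lemma orbit_closure_in_topspace: "z \<in> orbit_closure A x \<Longrightarrow> z \<in> topspace (full_shift A)"
  by (simp add: orbit_closure_def closure_of_def)

lemma orbit_closure_agree:
  assumes "z \<in> orbit_closure A x"
  obtains n where "agree N z (translate n x)"
proof -
  let ?U = "{w \<in> topspace (full_shift A). agree N z w}"
  have "openin (full_shift A) ?U"
    by (rule openin_full_shift_local[of N]) (simp add: agree_def)
  moreover have "z \<in> ?U"
    using orbit_closure_in_topspace[OF assms] by (simp add: agree_def)
  moreover have cl: "\<forall>U. z \<in> U \<and> openin (full_shift A) U \<longrightarrow> (\<exists>y\<in>orbit x. y \<in> U)"
    using assms unfolding orbit_closure_def closure_of_def by (elim CollectE conjE)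
  ultimately have "\<exists>y\<in>orbit x. y \<in> ?U"
    by (intro cl[rule_format, of ?U] conjI)
  then obtain y where "y \<in> orbit x" "agree N z y"
    by (elim bexE CollectE conjE)
  then show thesis
    unfolding orbit_translate by (elim rangeE) (rule that, simp only:)
qed

lemma orbit_closureI:
  assumes x: "x \<in> topspace (full_shift A)" and z: "z \<in> topspace (full_shift A)"
    and agree: "\<And>N. \<exists>n. agree N z (translate n x)"
  shows "z \<in> orbit_closure A x"
proof -
  have "\<exists>y\<in>orbit x. y \<in> U" if U: "z \<in> U" "openin (full_shift A) U" for U
  proof -
    obtain N where N: "\<And>w. w \<in> topspace (full_shift A) \<Longrightarrow> agree N z w \<Longrightarrow> w \<in> U"
      using openin_full_shift_agree[OF U(2,1)] by blast
    obtain n where "agree N z (translate n x)" using agree by blast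
    then have "translate n x \<in> U" by (intro N translate_in_topspace x)
    then show ?thesis unfolding orbit_translate by blast
  qed
  then show ?thesis unfolding orbit_closure_def closure_of_def using z by simp
qed

lemma subshift_subset: "subshift A X \<Longrightarrow> X \<subseteq> topspace (full_shift A)"
  by (simp add: subshift_def closedin_subset)

lemma subshift_translate:
  assumes "subshift A X" "x \<in> X"
  shows "translate n x \<in> X"
proof -
  have s: "shift = translate 1" by (auto simp: shift_def translate_def fun_eq_iff)
  have im: "translate 1 ` X = X" using assms(1) by (simp add: subshift_def s)
  have pos: "translate (int k) x \<in> X" if "x \<in> X" for k x
    using that
  proof (induction k arbitrary: x)
    case (Suc k)
    have "translate 1 x \<in> X" using im Suc.prems by blast
    from Suc.IH[OF this] show ?case by (simp add: add.commute)
  qed simp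
  have neg: "translate (- int k) x \<in> X" if "x \<in> X" for k x
    using that
  proof (induction k arbitrary: x)
    case (Suc k)
    obtain y where "y \<in> X" "x = translate 1 y" using im Suc.prems by blast
    then show ?case using Suc.IH[of y] by simp
  qed simp
  show ?thesis
    using pos[OF assms(2), of "nat n"] neg[OF assms(2), of "nat (- n)"] by (cases "n \<ge> 0") auto
qed

lemma orbit_closure_subset:
  assumes "subshift A X" "x \<in> X"
  shows "orbit_closure A x \<subseteq> X"
  unfolding orbit_closure_def
proof (rule closure_of_minimal)
  show "orbit x \<subseteq> X" using subshift_translate[OF assms] by (auto simp: orbit_translate)
  show "closedin (full_shift A) X" using assms(1) by (simp add: subshift_def)
qed


section \<open>Periodic parts and skeletons\<close>

lemma Per_add [simp]: "i + k * int p \<in> Per p x \<longleftrightarrow> i \<in> Per p x"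
proof -
  have *: "i + k * int p \<in> Per p x" if "i \<in> Per p x" for i k
  proof -
    have "x (i + k * int p) = x (i + k * int p + l * int p)" for l
    proof -
      have "x i = x (i + k * int p)" "x i = x (i + (k + l) * int p)"
        using that unfolding Per_def by blast+
      then show ?thesis by (simp add: algebra_simps)
    qed
    then show ?thesis by (simp add: Per_def)
  qed
  from *[of "i + k * int p" "- k"] *[of i k] show ?thesis by auto
qed

lemma Per_diff [simp]: "i - k * int p \<in> Per p x \<longleftrightarrow> i \<in> Per p x"
  using Per_add[of i "- k" p x] by simp

lemma Per_value: "i \<in> Per p x \<Longrightarrow> x (i + k * int p) = x i"
  by (simp add: Per_def)

lemma Per_translate [simp]: "i \<in> Per p (translate n x) \<longleftrightarrow> i + n \<in> Per p x"
  by (simp add: Per_def translate_def algebra_simps)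

lemma Per_dvd: "p dvd q \<Longrightarrow> Per p x \<subseteq> Per q x"
proof
  fix i assume "p dvd q" and i: "i \<in> Per p x"
  then obtain m where "q = p * m" by blast
  then have "x i = x (i + k * int q)" for k
    using Per_value[OF i, of "k * int m"] by (simp add: algebra_simps)
  then show "i \<in> Per q x" by (simp add: Per_def)
qed

text \<open>The p-skeleton of Toeplitz theory, with \<open>None\<close> marking the holes. Points of
  one orbit closure share their skeletons up to translation, so statements about holes can be
  carried from the generating point to all others.\<close>

definition skeleton :: "nat \<Rightarrow> (int \<Rightarrow> 'a) \<Rightarrow> int \<Rightarrow> 'a option" where
  "skeleton p x i = (if i \<in> Per p x then Some (x i) else None)"

lemma skeleton_eqI:
  assumes "\<And>i. i \<in> Per p x \<longleftrightarrow> i \<in> Per p y" "\<And>i. i \<in> Per p x \<Longrightarrow> x i = y i"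
  shows "skeleton p x = skeleton p y"
  using assms by (auto simp: skeleton_def fun_eq_iff)

lemma skeleton_eq_Per: "skeleton p x = skeleton p y \<Longrightarrow> Per p x = Per p y"
  by (auto simp: skeleton_def fun_eq_iff split: if_splits)

lemma skeleton_eq_value: "skeleton p x = skeleton p y \<Longrightarrow> i \<in> Per p x \<Longrightarrow> x i = y i"
  unfolding skeleton_def fun_eq_iff by (metis option.distinct(1) option.inject)

lemma skeleton_translate: "skeleton p (translate n x) = translate n (skeleton p x)"
  by (simp add: skeleton_def fun_eq_iff translate_apply)

lemma skeleton_translate_cong:
  "skeleton p x = skeleton p y \<Longrightarrow> skeleton p (translate n x) = skeleton p (translate n y)"
  by (simp add: skeleton_translate)

lemma skeleton_translate_mult: "skeleton p (translate (k * int p) x) = skeleton p x"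
  by (rule skeleton_eqI) (simp_all add: translate_apply Per_value)

text \<open>For a p-periodic position of \<open>x\<close>, its whole residue class modulo
  \<open>p\<close> lies in \<open>Per q x\<close>, and there \<open>y\<close> copies the constant
  value of \<open>x\<close>. The roles of \<open>x\<close> and \<open>y\<close> can be
  exchanged.\<close>

lemma skeleton_coarsen:
  assumes "p dvd q" "skeleton q x = skeleton q y"
  shows "skeleton p x = skeleton p y"
proof -
  have *: "i \<in> Per p y \<and> x i = y i" if "i \<in> Per p x" "skeleton q x = skeleton q y" for i and x y :: "int \<Rightarrow> 'a"
  proof -
    have "y (i + k * int p) = x i" for k
    proof -
      have "i + k * int p \<in> Per q x"
        by (rule subsetD[OF Per_dvd[OF assms(1)]]) (simp add: that(1))
      from skeleton_eq_value[OF that(2) this] show ?thesis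
        using Per_value[OF that(1)] by simp
    qed
    from this[of 0] this show ?thesis by (simp add: Per_def)
  qed
  show ?thesis
    by (rule skeleton_eqI) (use * assms(2) in \<open>metis\<close>)+
qed

section \<open>Period structures\<close>

lemma period_seq_dvd:
  assumes "period_seq p" "1 \<le> s" "s \<le> t"
  shows "p s dvd p t"
  using assms(3)
proof (induction t rule: dec_induct)
  case (step n)
  then have "p n dvd p (n + 1)" using assms by (simp add: period_seq_def)
  then show ?case using step dvd_trans by auto
qed simp

text \<open>Divisibility makes \<open>Per (p s) x\<close> grow with \<open>s\<close>, so the
  finitely many positions of a window are all absorbed from one level on.\<close>

lemma period_structure_eventually:
  assumes "period_structure x p"
  shows "\<exists>T\<ge>1. \<forall>s\<ge>T. \<forall>i. \<bar>i\<bar> \<le> int N \<longrightarrow> i \<in> Per (p s) x"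
proof -
  have "\<forall>i. \<exists>t\<ge>1. i \<in> Per (p t) x"
    using assms unfolding period_structure_def by (metis UNIV_I UN_E atLeast_iff)
  then obtain \<tau> where \<tau>: "\<And>i. \<tau> i \<ge> 1" "\<And>i. i \<in> Per (p (\<tau> i)) x" by metis
  define T where "T = Max (\<tau> ` {- int N..int N})"
  have T: "\<tau> i \<le> T" if "\<bar>i\<bar> \<le> int N" for i
    unfolding T_def by (intro Max_ge finite_imageI imageI) (use that in auto)
  have "T \<ge> 1" using T[of 0] \<tau>(1)[of 0] by simp
  moreover have "i \<in> Per (p s) x" if "s \<ge> T" "\<bar>i\<bar> \<le> int N" for s i
  proof -
    have "p (\<tau> i) dvd p s"
      using assms T[OF that(2)] that(1) \<tau>(1) by (intro period_seq_dvd) (auto simp: period_structure_def)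
    then show ?thesis using \<tau>(2) Per_dvd by blast
  qed
  ultimately show ?thesis by blast
qed

text \<open>Pigeonhole over the residues modulo \<open>q\<close>: if each residue \<open>j\<close>
  failed at some scale \<open>Nf j\<close>, a translate matching \<open>z\<close> at the largest of
  these finitely many scales would contradict the failure of its own residue.\<close>

lemma agree_translate_residue:
  assumes "\<And>N. \<exists>n. agree N z (translate n x)" and "0 < q"
  shows "\<exists>j. \<forall>N. \<exists>m. agree N z (translate (j + m * int q) x)"
proof (rule ccontr)
  assume "\<not> ?thesis"
  then obtain Nf where Nf: "\<And>j m. \<not> agree (Nf j) z (translate (j + m * int q) x)" by metis
  define N where "N = Max (Nf ` {0..<int q})"
  obtain n where n: "agree N z (translate n x)" using assms(1) by blast
  define j where "j = n mod int q"
  have "Nf j \<le> N" unfolding N_def j_def using assms(2) by (intro Max_ge) auto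
  then have "agree (Nf j) z (translate n x)" using n agree_mono by blast
  moreover have "n = j + (n div int q) * int q" by (simp add: j_def)
  ultimately show False using Nf by metis
qed

text \<open>Approximating \<open>z\<close> by translates from one residue class \<open>j\<close>
  modulo a large period \<open>q\<close> gives \<open>z i = x (i + j)\<close> wherever
  \<open>i + j\<close> is q-periodic for \<open>x\<close>. The period \<open>q\<close> is so large
  that, for every hole in one period of length \<open>p s\<close>, it covers two positions
  exhibiting that hole. Hence both periodic positions and holes pass to \<open>z\<close>.\<close>

lemma skeleton_orbit_closure:
  assumes x: "period_structure x p" "x \<in> topspace (full_shift A)"
    and z: "z \<in> orbit_closure A x" and s: "1 \<le> s"
  shows "\<exists>j. skeleton (p s) z = skeleton (p s) (translate j x)"
proof -
  have ps: "period_seq p" and pos: "0 < p s"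
    using x(1) s by (auto simp: period_structure_def period_seq_def)
  have "\<forall>i. \<exists>k. i \<notin> Per (p s) x \<longrightarrow> x i \<noteq> x (i + k * int (p s))" by (auto simp: Per_def)
  then obtain \<kappa> where \<kappa>: "\<And>i. i \<notin> Per (p s) x \<Longrightarrow> x i \<noteq> x (i + \<kappa> i * int (p s))" by metis
  \<comment> \<open>\<open>b i\<close> bounds a hole \<open>i\<close> and the position where its
    value changes, so the window of radius \<open>N\<close> exposes all holes of one period.\<close>
  define b where "b = (\<lambda>i. \<bar>i\<bar> + \<bar>i + \<kappa> i * int (p s)\<bar>)"
  define N where "N = nat (Max (b ` {0..<int (p s)}))"
  have N: "b i \<le> int N" if "i \<in> {0..<int (p s)}" for i
  proof -
    have "b i \<le> Max (b ` {0..<int (p s)})" using that by (intro Max_ge) auto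
    then show ?thesis by (simp add: N_def)
  qed
  obtain T where T: "T \<ge> 1" "\<And>t i. t \<ge> T \<Longrightarrow> \<bar>i\<bar> \<le> int N \<Longrightarrow> i \<in> Per (p t) x"
    using period_structure_eventually[OF x(1)] by blast
  define q where "q = p (max s T)"
  have pq: "p s dvd q" unfolding q_def using s by (intro period_seq_dvd ps) auto
  have Perq: "i \<in> Per q x" if "\<bar>i\<bar> \<le> int N" for i
    unfolding q_def using that by (intro T) auto
  have q: "0 < q" using ps s by (simp add: q_def period_seq_def)
  have "\<And>N. \<exists>n. agree N z (translate n x)"
    using orbit_closure_agree[OF z] by metis
  then obtain j where j: "\<And>N. \<exists>m. agree N z (translate (j + m * int q) x)"
    using agree_translate_residue[OF _ q] by metis
  have val: "z i = x (i + j)" if "i + j \<in> Per q x" for i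
  proof -
    obtain m where "agree (nat \<bar>i\<bar>) z (translate (j + m * int q) x)" using j by blast
    then have "z i = x (i + j + m * int q)" by (simp add: agree_def translate_apply algebra_simps)
    then show ?thesis using Per_value[OF that] by simp
  qed
  have iff: "i \<in> Per (p s) z \<longleftrightarrow> i + j \<in> Per (p s) x" for i
  proof
    assume "i + j \<in> Per (p s) x"
    have "z (i + k * int (p s)) = x (i + j)" for k
    proof -
      have *: "(i + j) + k * int (p s) \<in> Per (p s) x" using \<open>i + j \<in> Per (p s) x\<close> by simp
      then have "i + k * int (p s) + j \<in> Per q x"
        using Per_dvd[OF pq, of x] by (auto simp: algebra_simps)
      then have "z (i + k * int (p s)) = x (i + j + k * int (p s))"
        using val by (simp add: algebra_simps)
      then show ?thesis using Per_value[OF \<open>i + j \<in> Per (p s) x\<close>] by simp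
    qed
    from this[of 0] this show "i \<in> Per (p s) z" by (simp add: Per_def)
  next
    assume iz: "i \<in> Per (p s) z"
    show "i + j \<in> Per (p s) x"
    proof (rule ccontr)
      assume h: "i + j \<notin> Per (p s) x"
      define a where "a = (i + j) mod int (p s)"
      have a: "i + j = a + ((i + j) div int (p s)) * int (p s)" by (simp add: a_def)
      have "a \<notin> Per (p s) x" using h by (subst (asm) a) simp
      then have ne: "x a \<noteq> x (a + \<kappa> a * int (p s))" by (rule \<kappa>)
      have "a \<in> {0..<int (p s)}" using pos by (simp add: a_def)
      then have "b a \<le> int N" by (rule N)
      then have "a \<in> Per q x" "a + \<kappa> a * int (p s) \<in> Per q x"
        by (auto intro!: Perq simp: b_def)
      then have "z (a - j) = x a" "z (a - j + \<kappa> a * int (p s)) = x (a + \<kappa> a * int (p s))"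
        using val[of "a - j"] val[of "a - j + \<kappa> a * int (p s)"] by (auto simp: algebra_simps)
      moreover have "a - j \<in> Per (p s) z"
      proof -
        have "a - j = i - ((i + j) div int (p s)) * int (p s)" using a by linarith
        then show ?thesis using iz by simp
      qed
      ultimately show False using ne Per_value by metis
    qed
  qed
  have "skeleton (p s) z = skeleton (p s) (translate j x)"
  proof (rule skeleton_eqI)
    fix i assume "i \<in> Per (p s) z"
    then have "i + j \<in> Per q x" using iff Per_dvd[OF pq] by blast
    then show "z i = translate j x i" by (simp add: translate_apply val)
  qed (simp add: iff)
  then show ?thesis by blast
qed

text \<open>Minimality: a window of \<open>w\<close> occurs in \<open>x\<close>, where it consists
  of positions periodic at some level \<open>T\<close>. Up to translation \<open>z\<close> has the
  same skeleton at that level, so the window occurs in \<open>z\<close> as well.\<close>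

lemma orbit_closure_eq:
  assumes X: "subshift A X" "X = orbit_closure A x" and x: "generalized_oxtoby A p x" and z: "z \<in> X"
  shows "orbit_closure A z = X"
proof
  show "orbit_closure A z \<subseteq> X" using orbit_closure_subset[OF X(1) z] .
  have xT: "x \<in> topspace (full_shift A)" and px: "period_structure x p"
    using x by (auto simp: generalized_oxtoby_def toeplitz_def)
  have zT: "z \<in> topspace (full_shift A)" using z subshift_subset[OF X(1)] by blast
  show "X \<subseteq> orbit_closure A z"
  proof
    fix w assume w: "w \<in> X"
    have "\<exists>n. agree N w (translate n z)" for N
    proof -
      obtain n where n: "agree N w (translate n x)"
        using w X(2) orbit_closure_agree by blast
      \<comment> \<open>The window of \<open>w\<close> sits in \<open>x\<close> around position
        \<open>n\<close>, hence the extra \<open>\<bar>n\<bar>\<close>.\<close>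
      define M where "M = N + nat \<bar>n\<bar>"
      obtain T where T: "T \<ge> 1" "\<And>i. \<bar>i\<bar> \<le> int M \<Longrightarrow> i \<in> Per (p T) x"
        using period_structure_eventually[OF px, of M] by blast
      obtain j where "skeleton (p T) z = skeleton (p T) (translate j x)"
        using skeleton_orbit_closure[OF px xT _ T(1)] z X(2) by blast
      from skeleton_translate_cong[OF this, of "- j"]
      have sk: "skeleton (p T) x = skeleton (p T) (translate (- j) z)" by simp
      have "w i = translate (n - j) z i" if "\<bar>i\<bar> \<le> int N" for i
      proof -
        have "\<bar>i + n\<bar> \<le> int M" using that by (simp add: M_def)
        from skeleton_eq_value[OF sk T(2)[OF this]] show ?thesis
          using n that by (simp add: agree_def translate_apply algebra_simps)
      qed
      then show ?thesis unfolding agree_def by blast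
    qed
    then show "w \<in> orbit_closure A z"
      using w subshift_subset[OF X(1)] by (intro orbit_closureI zT) auto
  qed
qed

section \<open>Cuts and block kernels\<close>

text \<open>One level of the Oxtoby condition, for the cut at the multiples of \<open>p\<close> and
  for arbitrary points. Any other cut is expressed by translating the point.\<close>

definition oxtoby_step :: "nat \<Rightarrow> nat \<Rightarrow> (int \<Rightarrow> 'a) \<Rightarrow> bool" where
  "oxtoby_step p q x \<longleftrightarrow>
     (\<forall>k::int. (\<exists>i\<in>{k * int p ..< (k + 1) * int p}. hole q x i) \<longrightarrow>
        (\<forall>i\<in>{k * int p ..< (k + 1) * int p}. hole p x i \<longrightarrow> hole q x i))"

text \<open>The two excluded situations, every hole filled and no hole filled, are those in which
  \<open>oxtoby_step\<close> holds for trivial reasons at every cut.\<close>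

definition proper_step :: "nat \<Rightarrow> nat \<Rightarrow> (int \<Rightarrow> 'a) \<Rightarrow> bool" where
  "proper_step p q x \<longleftrightarrow> (\<exists>i. hole q x i) \<and> (\<exists>i. hole p x i \<and> \<not> hole q x i)"

definition good :: "nat \<Rightarrow> nat \<Rightarrow> (int \<Rightarrow> 'a) set \<Rightarrow> (int \<Rightarrow> 'a) set" where
  "good p q X = {x \<in> X. oxtoby_step p q x \<and> proper_step p q x}"

definition block_kernel :: "nat \<Rightarrow> (int \<Rightarrow> 'a) \<Rightarrow> (int \<times> int) set" where
  "block_kernel p x = {(k, l). \<forall>i\<in>{0..<int p}. x (i + k * int p) = x (i + l * int p)}"

section \<open>Holes, steps and kernels under translation\<close>

lemma hole_add [simp]: "hole p x (i + k * int p) \<longleftrightarrow> hole p x i"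
  by (simp add: hole_def)

lemma hole_translate [simp]: "hole p (translate n x) i \<longleftrightarrow> hole p x (i + n)"
  by (simp add: hole_def)

lemma hole_cong: "skeleton p x = skeleton p y \<Longrightarrow> hole p x = hole p y"
  using skeleton_eq_Per[of p x y] by (auto simp: hole_def fun_eq_iff)

lemma step_cong:
  assumes "p dvd q" "skeleton q x = skeleton q y"
  shows "oxtoby_step p q x \<longleftrightarrow> oxtoby_step p q y" "proper_step p q x \<longleftrightarrow> proper_step p q y"
  using hole_cong[OF assms(2)] hole_cong[OF skeleton_coarsen[OF assms]]
  by (simp_all add: oxtoby_step_def proper_step_def)

lemma proper_step_translate [simp]: "proper_step p q (translate n x) \<longleftrightarrow> proper_step p q x"
proof -
  have "(\<exists>i. P (i + n)) \<longleftrightarrow> (\<exists>i. P i)" for P :: "int \<Rightarrow> bool"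
    by (metis diff_add_cancel)
  from this[of "hole q x"] this[of "\<lambda>i. hole p x i \<and> \<not> hole q x i"]
  show ?thesis by (simp add: proper_step_def)
qed

lemma oxtoby_step_translate:
  assumes "oxtoby_step p q x"
  shows "oxtoby_step p q (translate (m * int p) x)"
  unfolding oxtoby_step_def hole_translate
proof (intro allI impI ballI)
  fix k i
  assume ex: "\<exists>i\<in>{k * int p..<(k + 1) * int p}. hole q x (i + m * int p)"
    and i: "i \<in> {k * int p..<(k + 1) * int p}" "hole p x (i + m * int p)"
  have w: "j + m * int p \<in> {(k + m) * int p..<(k + m + 1) * int p}"
    if "j \<in> {k * int p..<(k + 1) * int p}" for j
    using that by (auto simp: algebra_simps)
  show "hole q x (i + m * int p)"
    using assms w ex i unfolding oxtoby_step_def by blast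
qed

text \<open>A position in \<open>Per p z\<close> never distinguishes two blocks. Moving the cut from
  \<open>m\<close> to \<open>n\<close> trades positions of \<open>[m, n)\<close> for their
  translates by \<open>p\<close>, and all of these are periodic.\<close>

lemma kernel_translate:
  assumes "m \<le> n" and per: "\<And>i. m \<le> i \<Longrightarrow> i < n \<Longrightarrow> i \<in> Per p z"
  shows "block_kernel p (translate m z) = block_kernel p (translate n z)"
proof -
  have *: "(k, l) \<in> block_kernel p (translate c z) \<longleftrightarrow>
      (\<forall>i\<in>{c..<c + int p}. z (i + k * int p) = z (i + l * int p))" for c k l
  proof -
    have "(\<forall>i\<in>{c..<c + int p}. P i) \<longleftrightarrow> (\<forall>i\<in>{0..<int p}. P (i + c))" for P :: "int \<Rightarrow> bool"
    proof
      assume R: "\<forall>i\<in>{0..<int p}. P (i + c)"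
      show "\<forall>i\<in>{c..<c + int p}. P i"
      proof
        fix i assume "i \<in> {c..<c + int p}"
        then show "P i" using R[rule_format, of "i - c"] by simp
      qed
    qed auto
    then show ?thesis by (simp add: block_kernel_def translate_apply ac_simps)
  qed
  have v: "z (i + k * int p) = z (i + l * int p)" if "i \<in> Per p z" for i k l
    using Per_value[OF that] by simp
  have pn: "i - int p \<in> Per p z \<longleftrightarrow> i \<in> Per p z" for i
    using Per_diff[of i 1 p z] by simp
  have "(k, l) \<in> block_kernel p (translate m z) \<longleftrightarrow> (k, l) \<in> block_kernel p (translate n z)" for k l
  proof -
    let ?E = "\<lambda>i. z (i + k * int p) = z (i + l * int p)"
    have sh: "?E (i + int p)" if "i \<in> Per p z" for i
      using that pn[of "i + int p"] v[of "i + int p"] by simp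
    have "(\<forall>i\<in>{m..<m + int p}. ?E i) \<longleftrightarrow> (\<forall>i\<in>{n..<n + int p}. ?E i)"
    proof
      assume L: "\<forall>i\<in>{m..<m + int p}. ?E i"
      show "\<forall>i\<in>{n..<n + int p}. ?E i"
      proof
        fix i assume i: "i \<in> {n..<n + int p}"
        show "?E i"
        proof (cases "i < m + int p")
          case True
          then show ?thesis using L i assms(1) by simp
        next
          case False
          then have "i - int p \<in> Per p z" using per i by simp
          then show ?thesis using sh[of "i - int p"] by simp
        qed
      qed
    next
      assume R: "\<forall>i\<in>{n..<n + int p}. ?E i"
      show "\<forall>i\<in>{m..<m + int p}. ?E i"
      proof
        fix i assume i: "i \<in> {m..<m + int p}"
        show "?E i"
        proof (cases "i < n")
          case True
          then show ?thesis using per i v by simp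
        next
          case False
          then show ?thesis using R i assms(1) by simp
        qed
      qed
    qed
    then show ?thesis unfolding * .
  qed
  then show ?thesis by auto
qed

section \<open>Essential uniqueness of the admissible cut\<close>

lemma oxtoby_step_window:
  assumes "oxtoby_step p q x"
    and "i \<in> {k * int p ..< (k + 1) * int p}" "hole p x i"
    and "j \<in> {k * int p ..< (k + 1) * int p}" "hole q x j"
  shows "hole q x i"
  using assms unfolding oxtoby_step_def by blast

text \<open>If holes lay on both sides of the second cut, every window of either point would share
  holes with two consecutive windows of the other, so filling would spread to all windows or to
  none.\<close>

lemma cut_in_gap:
  fixes j :: int and z v :: "int \<Rightarrow> 'a"
  assumes p: "0 < p" "p dvd q" and j: "0 \<le> j" "j < int p"
    and z: "oxtoby_step p q z" "proper_step p q z" and v: "oxtoby_step p q (translate j v)"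
    and left: "\<And>r k. r \<in> {p, q} \<Longrightarrow>
      (\<exists>i\<in>{k * int p ..< k * int p + j}. hole r z i) \<longleftrightarrow> (\<exists>i\<in>{k * int p ..< k * int p + j}. hole r v i)"
    and right: "\<And>r k. r \<in> {p, q} \<Longrightarrow>
      (\<exists>i\<in>{k * int p + j ..< (k + 1) * int p}. hole r z i) \<longleftrightarrow>
      (\<exists>i\<in>{k * int p + j ..< (k + 1) * int p}. hole r v i)"
  shows "(\<forall>i\<in>{0..<j}. i \<in> Per p v) \<or> (\<forall>i\<in>{j..<int p}. i \<in> Per p v)"
proof (rule ccontr)
  assume "\<not> ?thesis"
  then obtain a b where a: "a \<in> {0..<j}" "hole p v a" and b: "b \<in> {j..<int p}" "hole p v b"
    by (auto simp: hole_def)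
  define L where "L = (\<lambda>r (x :: int \<Rightarrow> 'a) k. \<exists>i\<in>{k * int p ..< k * int p + j}. hole r x i)"
  define R where "R = (\<lambda>r (x :: int \<Rightarrow> 'a) k. \<exists>i\<in>{k * int p + j ..< (k + 1) * int p}. hole r x i)"
  have Lzv: "L r z k \<longleftrightarrow> L r v k" and Rzv: "R r z k \<longleftrightarrow> R r v k" if "r \<in> {p, q}" for r k
    using left[OF that] right[OF that] by (simp_all add: L_def R_def)
  have Lv: "L p v k" for k
    unfolding L_def using a by (intro bexI[of _ "a + k * int p"]) auto
  have Rv: "R p v k" for k
    unfolding R_def using b by (intro bexI[of _ "b + k * int p"]) (auto simp: algebra_simps)
  have zLR: "L q z k \<longleftrightarrow> R q z k" for k
  proof
    assume "L q z k"
    then obtain i where i: "i \<in> {k * int p ..< k * int p + j}" "hole q z i" by (auto simp: L_def)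
    obtain i' where i': "i' \<in> {k * int p + j ..< (k + 1) * int p}" "hole p z i'"
      using Rv[of k] Rzv[of p k] by (auto simp: R_def)
    have "hole q z i'"
      using i i' j by (intro oxtoby_step_window[OF z(1), of i' k i]) (auto simp: algebra_simps)
    then show "R q z k" using i' by (auto simp: R_def)
  next
    assume "R q z k"
    then obtain i where i: "i \<in> {k * int p + j ..< (k + 1) * int p}" "hole q z i" by (auto simp: R_def)
    obtain i' where i': "i' \<in> {k * int p ..< k * int p + j}" "hole p z i'"
      using Lv[of k] Lzv[of p k] by (auto simp: L_def)
    have "hole q z i'"
      using i i' j by (intro oxtoby_step_window[OF z(1), of i' k i]) (auto simp: algebra_simps)
    then show "L q z k" using i' by (auto simp: L_def)
  qed
  \<comment> \<open>A window of the cut of \<open>v\<close> consists of the right part of window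
    \<open>k\<close> and the left part of window \<open>k + 1\<close>; this links consecutive
    windows.\<close>
  have vstep: "hole q v i"
    if "i \<in> {k * int p + j ..< (k + 1) * int p + j}" "hole p v i"
      "i' \<in> {k * int p + j ..< (k + 1) * int p + j}" "hole q v i'" for i i' k
    using oxtoby_step_window[OF v, of "i - j" k "i' - j"] that by (simp add: algebra_simps)
  have vRL: "R q v k \<longleftrightarrow> L q v (k + 1)" for k
  proof
    assume "R q v k"
    then obtain i where i: "i \<in> {k * int p + j ..< (k + 1) * int p}" "hole q v i" by (auto simp: R_def)
    obtain i' where i': "i' \<in> {(k + 1) * int p ..< (k + 1) * int p + j}" "hole p v i'"
      using Lv[of "k + 1"] by (auto simp: L_def)
    have "hole q v i'" using i i' j by (intro vstep[of i' k i]) (auto simp: algebra_simps)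
    then show "L q v (k + 1)" using i' by (auto simp: L_def)
  next
    assume "L q v (k + 1)"
    then obtain i where i: "i \<in> {(k + 1) * int p ..< (k + 1) * int p + j}" "hole q v i" by (auto simp: L_def)
    obtain i' where i': "i' \<in> {k * int p + j ..< (k + 1) * int p}" "hole p v i'"
      using Rv[of k] by (auto simp: R_def)
    have "hole q v i'" using i i' j by (intro vstep[of i' k i]) (auto simp: algebra_simps)
    then show "R q v k" using i' by (auto simp: R_def)
  qed
  have succ: "L q z k \<longleftrightarrow> L q z (k + 1)" for k
    using zLR[of k] Rzv[of q k] vRL[of k] Lzv[of q "k + 1"] by simp
  have all: "L q z k \<longleftrightarrow> L q z 0" for k
  proof (induction k rule: int_induct[where k = 0])
    case (step1 i)
    then show ?case using succ[of i] by simp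
  next
    case (step2 i)
    then show ?case using succ[of "i - 1"] by simp
  qed simp
  \<comment> \<open>Either every window of \<open>z\<close> has a q-hole, so that no p-hole is
    filled, or there is no q-hole at all. Properness of \<open>z\<close> rules out both.\<close>
  have window: "i \<in> {(i div int p) * int p ..< (i div int p + 1) * int p}" for i
    using p(1) by (simp add: algebra_simps mod_pos_pos_trivial minus_mod_eq_mult_div [symmetric])
  show False
  proof (cases "L q z 0")
    case True
    obtain i where i: "hole p z i" "\<not> hole q z i" using z(2) by (auto simp: proper_step_def)
    obtain i' where i': "i' \<in> {(i div int p) * int p ..< (i div int p) * int p + j}" "hole q z i'"
      using all[of "i div int p"] True by (auto simp: L_def)
    have "i' \<in> {(i div int p) * int p ..< (i div int p + 1) * int p}"
      using i' j by (auto simp: algebra_simps)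
    then show False using oxtoby_step_window[OF z(1) window i(1)] i(2) i'(2) by blast
  next
    case False
    obtain i where i: "hole q z i" using z(2) by (auto simp: proper_step_def)
    have "L p z (i div int p)" using Lv Lzv by simp
    then obtain i' where i': "i' \<in> {(i div int p) * int p ..< (i div int p) * int p + j}" "hole p z i'"
      by (auto simp: L_def)
    have "i' \<in> {(i div int p) * int p ..< (i div int p + 1) * int p}"
      using i' j by (auto simp: algebra_simps)
    then have "hole q z i'" using oxtoby_step_window[OF z(1) _ i'(2) window i] by blast
    then have "L q z (i div int p)" using i'(1) by (auto simp: L_def)
    then show False using all False by blast
  qed
qed

text \<open>The cut at \<open>0\<close> slides across the hole-free side: forward to
  \<open>j\<close> with \<open>m = 0\<close>, or back to \<open>j - p\<close> with
  \<open>m = -1\<close>, where the interval crossed is the second gap shifted by one period.\<close>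

lemma kernel_move_cut:
  fixes j :: int
  assumes j: "0 \<le> j" "j < int p"
    and gap: "(\<forall>i\<in>{0..<j}. i \<in> Per p v) \<or> (\<forall>i\<in>{j..<int p}. i \<in> Per p v)"
  obtains m where "block_kernel p (translate (j + m * int p) v) = block_kernel p v"
  using gap
proof
  assume "\<forall>i\<in>{0..<j}. i \<in> Per p v"
  then have "block_kernel p (translate 0 v) = block_kernel p (translate j v)"
    using j by (intro kernel_translate) auto
  then show ?thesis using that[of 0] by simp
next
  assume *: "\<forall>i\<in>{j..<int p}. i \<in> Per p v"
  have "block_kernel p (translate (j - int p) v) = block_kernel p (translate 0 v)"
  proof (rule kernel_translate)
    fix i assume "j - int p \<le> i" "i < 0"
    then have "i + 1 * int p \<in> Per p v" using * by (simp del: Per_add)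
    then show "i \<in> Per p v" by (simp only: Per_add)
  qed (use j in simp)
  then show ?thesis using that[of "-1"] by simp
qed

text \<open>Translation by the residue \<open>c\<close> of \<open>- j\<close> takes \<open>w\<close>
  to the skeleton of \<open>x\<close> up to a multiple of \<open>p\<close>. So \<open>w\<close> is
  admissible both at its own cut and at the one inherited from \<open>x\<close>, and by uniqueness
  the second may replace the first without changing the kernel.\<close>

lemma good_normalize:
  assumes p: "0 < p" "p dvd q" and x: "oxtoby_step p q x" and w: "w \<in> good p q X"
    and j: "skeleton q w = skeleton q (translate j x)"
  obtains n k where "block_kernel p (translate n w) = block_kernel p w"
    "skeleton q (translate n w) = skeleton q (translate (k * int p) x)"
proof -
  define c where "c = (- j) mod int p"
  have c: "0 \<le> c" "c < int p" using p(1) by (simp_all add: c_def)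
  have jc: "\<exists>k. c + j = k * int p"
    by (intro exI[of _ "- ((- j) div int p)"]) (simp add: c_def minus_div_mult_eq_mod [symmetric])
  then obtain k where k: "c + j = k * int p" by blast
  have sk: "skeleton q (translate (c + m * int p) w) = skeleton q (translate ((k + m) * int p) x)" for m
  proof -
    have "c + m * int p + j = (k + m) * int p" using k by (simp add: algebra_simps)
    then show ?thesis
      using skeleton_translate_cong[OF j, of "c + m * int p"] by (simp only: translate_translate)
  qed
  have "oxtoby_step p q (translate c w)"
    using step_cong(1)[OF p(2) sk[of 0]] oxtoby_step_translate[OF x] by simp
  \<comment> \<open>\<open>w\<close> plays both points of \<open>cut_in_gap\<close>, so the required
    agreement of holes is trivial.\<close>
  then have "(\<forall>i\<in>{0..<c}. i \<in> Per p w) \<or> (\<forall>i\<in>{c..<int p}. i \<in> Per p w)"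
    using w by (intro cut_in_gap[OF p c, of w]) (auto simp: good_def)
  then obtain m where "block_kernel p (translate (c + m * int p) w) = block_kernel p w"
    using kernel_move_cut[OF c] by blast
  then show ?thesis using that sk by blast
qed


section \<open>Local conjugacies\<close>

text \<open>A sliding block code of radius \<open>r\<close>, expressed without a block function.
  Comparing windows at two unrelated positions \<open>i\<close> and \<open>j\<close> encodes
  equivariance together with uniform continuity.\<close>

definition local_map :: "nat \<Rightarrow> (int \<Rightarrow> 'a) set \<Rightarrow> ((int \<Rightarrow> 'a) \<Rightarrow> int \<Rightarrow> 'a) \<Rightarrow> bool" where
  "local_map r X f \<longleftrightarrow> (\<forall>z\<in>X. \<forall>w\<in>X. \<forall>i j.
     (\<forall>d. \<bar>d\<bar> \<le> int r \<longrightarrow> z (i + d) = w (j + d)) \<longrightarrow> f z i = f w j)"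

lemma local_mapD:
  assumes "local_map r X f" "z \<in> X" "w \<in> X" "\<And>d. \<bar>d\<bar> \<le> int r \<Longrightarrow> z (i + d) = w (j + d)"
  shows "f z i = f w j"
  using assms unfolding local_map_def by blast

lemma local_map_Per:
  assumes "local_map r X f" "z \<in> X" "\<And>d. \<bar>d\<bar> \<le> int r \<Longrightarrow> i + d \<in> Per p z"
  shows "i \<in> Per p (f z)"
  unfolding Per_def
proof (intro CollectI allI)
  fix k
  show "f z i = f z (i + k * int p)"
  proof (rule local_mapD[OF assms(1,2,2)])
    fix d :: int assume "\<bar>d\<bar> \<le> int r"
    from Per_value[OF assms(3)[OF this], of k] show "z (i + d) = z (i + k * int p + d)"
      by (simp add: algebra_simps)
  qed
qed

text \<open>If the window saw only periodic positions, the image would be periodic at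
  \<open>i\<close>. Used for a conjugacy and for its inverse, this bounds the displacement of holes
  in both directions.\<close>

lemma local_map_hole:
  assumes "local_map r X f" "z \<in> X" "hole p (f z) i"
  shows "\<exists>i'. \<bar>i' - i\<bar> \<le> int r \<and> hole p z i'"
proof -
  obtain d where "\<bar>d\<bar> \<le> int r" "i + d \<notin> Per p z"
    using local_map_Per[OF assms(1,2)] assms(3) by (auto simp: hole_def)
  then show ?thesis by (intro exI[of _ "i + d"]) (simp add: hole_def)
qed

lemma local_map_translate:
  assumes "local_map r X f" "z \<in> X" "translate n z \<in> X"
  shows "f (translate n z) = translate n (f z)"
proof
  fix i show "f (translate n z) i = translate n (f z) i"
    unfolding translate_apply[of n "f z"]
    by (rule local_mapD[OF assms(1,3,2)]) (simp add: translate_apply ac_simps)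
qed

text \<open>A block of \<open>f z\<close> is computed from the block of \<open>z\<close> extended by
  \<open>r\<close> on either side. The margin around \<open>0\<close>, repeated at \<open>p\<close>
  by periodicity, makes the overhang the same for all blocks, so equal blocks have equal
  images.\<close>

lemma local_map_kernel:
  assumes f: "local_map r X f" "z \<in> X" and per: "\<And>i. \<bar>i\<bar> \<le> int r \<Longrightarrow> i \<in> Per p z"
  shows "block_kernel p z \<subseteq> block_kernel p (f z)"
proof clarify
  fix k l assume kl: "(k, l) \<in> block_kernel p z"
  have E: "z (i + k * int p) = z (i + l * int p)" if "- int r \<le> i" "i < int p + int r" for i
  proof -
    have P: ?thesis if "i \<in> Per p z" using Per_value[OF that] by simp
    show ?thesis
    proof (cases "0 \<le> i \<and> i < int p")
      case True
      then show ?thesis using kl by (simp add: block_kernel_def)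
    next
      case False
      then consider "i < 0" | "i \<ge> int p" by linarith
      then show ?thesis
      proof cases
        case 1
        then show ?thesis using that by (intro P per) simp
      next
        case 2
        then have "i - 1 * int p \<in> Per p z" using that by (intro per) simp
        then show ?thesis unfolding Per_diff by (rule P)
      qed
    qed
  qed
  have "f z (i + k * int p) = f z (i + l * int p)" if i: "i \<in> {0..<int p}" for i
  proof (rule local_mapD[OF f(1,2,2)])
    fix d :: int assume "\<bar>d\<bar> \<le> int r"
    then have "z (i + d + k * int p) = z (i + d + l * int p)"
      using i by (intro E) auto
    then show "z (i + k * int p + d) = z (i + l * int p + d)" by (simp add: ac_simps)
  qed
  then show "(k, l) \<in> block_kernel p (f z)" by (simp add: block_kernel_def)
qed

section \<open>Conjugacies acting on holes and kernels\<close>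

definition local_conj :: "nat \<Rightarrow> (int \<Rightarrow> 'a) set \<Rightarrow> (int \<Rightarrow> 'a) set \<Rightarrow>
    ((int \<Rightarrow> 'a) \<Rightarrow> int \<Rightarrow> 'a) \<Rightarrow> ((int \<Rightarrow> 'a) \<Rightarrow> int \<Rightarrow> 'a) \<Rightarrow> bool" where
  "local_conj r X Y f g \<longleftrightarrow> local_map r X f \<and> local_map r Y g \<and>
     (\<forall>z\<in>X. f z \<in> Y \<and> g (f z) = z) \<and> (\<forall>w\<in>Y. g w \<in> X \<and> f (g w) = w)"

lemma local_conj_sym: "local_conj r X Y f g \<Longrightarrow> local_conj r Y X g f"
  by (auto simp: local_conj_def)

text \<open>The margin is \<open>2 * r\<close> because \<open>f\<close> consumes \<open>r\<close> of
  it, and \<open>g\<close> needs the remaining \<open>r\<close> around the image for the reverse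
  inclusion.\<close>

lemma local_conj_kernel:
  assumes fg: "local_conj r X Y f g" and z: "z \<in> X"
    and per: "\<And>i. \<bar>i\<bar> \<le> 2 * int r \<Longrightarrow> i \<in> Per p z"
  shows "block_kernel p (f z) = block_kernel p z"
proof
  have u: "f z \<in> Y" "g (f z) = z" and f: "local_map r X f" and g: "local_map r Y g"
    using fg z by (auto simp: local_conj_def)
  show "block_kernel p z \<subseteq> block_kernel p (f z)"
    by (rule local_map_kernel[OF f z per]) simp
  have "i \<in> Per p (f z)" if "\<bar>i\<bar> \<le> int r" for i
    using that by (intro local_map_Per[OF f z] per) linarith
  from local_map_kernel[OF g u(1) this] show "block_kernel p (f z) \<subseteq> block_kernel p z" by (simp add: u)
qed

text \<open>The periodic margins around the two ends keep nearby holes of the two points on the same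
  side.\<close>

lemma holes_between:
  fixes a b :: int and z v :: "int \<Rightarrow> 'a"
  assumes zv: "\<And>i. hole s z i \<Longrightarrow> \<exists>i'. \<bar>i' - i\<bar> \<le> int r \<and> hole s v i'"
    and vz: "\<And>i. hole s v i \<Longrightarrow> \<exists>i'. \<bar>i' - i\<bar> \<le> int r \<and> hole s z i'"
    and a: "(\<forall>i. \<bar>i - a\<bar> \<le> int r \<longrightarrow> \<not> hole s z i) \<or> (\<forall>i. \<bar>i - a\<bar> \<le> int r \<longrightarrow> \<not> hole s v i)"
    and b: "(\<forall>i. \<bar>i - b\<bar> \<le> int r \<longrightarrow> \<not> hole s z i) \<or> (\<forall>i. \<bar>i - b\<bar> \<le> int r \<longrightarrow> \<not> hole s v i)"
  shows "(\<exists>i\<in>{a..<b}. hole s z i) \<longleftrightarrow> (\<exists>i\<in>{a..<b}. hole s v i)"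
proof -
  have *: "\<exists>i\<in>{a..<b}. hole s v i"
    if near: "\<And>i. hole s z i \<Longrightarrow> \<exists>i'. \<bar>i' - i\<bar> \<le> int r \<and> hole s v i'"
      and ends: "\<And>c. c \<in> {a, b} \<Longrightarrow>
        (\<forall>i. \<bar>i - c\<bar> \<le> int r \<longrightarrow> \<not> hole s z i) \<or> (\<forall>i. \<bar>i - c\<bar> \<le> int r \<longrightarrow> \<not> hole s v i)"
      and i: "i \<in> {a..<b}" "hole s z i" for i and z v :: "int \<Rightarrow> 'a"
  proof -
    obtain i' where i': "\<bar>i' - i\<bar> \<le> int r" "hole s v i'" using near[OF i(2)] by blast
    have "i' \<ge> a"
    proof (rule ccontr)
      assume "\<not> i' \<ge> a"
      then have "\<bar>i - a\<bar> \<le> int r" "\<bar>i' - a\<bar> \<le> int r" using i(1) i'(1) by auto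
      then show False using ends[of a] i(2) i'(2) by auto
    qed
    moreover have "i' < b"
    proof (rule ccontr)
      assume "\<not> i' < b"
      then have "\<bar>i - b\<bar> \<le> int r" "\<bar>i' - b\<bar> \<le> int r" using i(1) i'(1) by auto
      then show False using ends[of b] i(2) i'(2) by auto
    qed
    ultimately show ?thesis using i'(2) by auto
  qed
  show ?thesis
  proof
    assume "\<exists>i\<in>{a..<b}. hole s z i"
    then obtain i where "i \<in> {a..<b}" "hole s z i" by blast
    then show "\<exists>i\<in>{a..<b}. hole s v i" using a b by (intro *[OF zv]) auto
  next
    assume "\<exists>i\<in>{a..<b}. hole s v i"
    then obtain i where "i \<in> {a..<b}" "hole s v i" by blast
    then show "\<exists>i\<in>{a..<b}. hole s z i" using a b by (intro *[OF vz]) auto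
  qed
qed

text \<open>A window of \<open>z\<close> in which a p-hole is filled has no q-hole at all. Comparing
  holes on both parts of this window shows the same for \<open>v\<close>, which gives a filled hole
  of \<open>v\<close>; a surviving one comes from \<open>zv\<close>.\<close>

lemma proper_step_transfer:
  assumes p: "0 < p" "p dvd q" and j: "0 \<le> j" "j < int p"
    and z: "oxtoby_step p q z" "proper_step p q z"
    and zv: "\<And>i. hole q z i \<Longrightarrow> \<exists>i'. hole q v i'"
    and left: "\<And>r k. r \<in> {p, q} \<Longrightarrow>
      (\<exists>i\<in>{k * int p ..< k * int p + j}. hole r z i) \<longleftrightarrow> (\<exists>i\<in>{k * int p ..< k * int p + j}. hole r v i)"
    and right: "\<And>r k. r \<in> {p, q} \<Longrightarrow>
      (\<exists>i\<in>{k * int p + j ..< (k + 1) * int p}. hole r z i) \<longleftrightarrow>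
      (\<exists>i\<in>{k * int p + j ..< (k + 1) * int p}. hole r v i)"
  shows "proper_step p q v"
proof -
  obtain i where i: "hole p z i" "\<not> hole q z i" using z(2) by (auto simp: proper_step_def)
  define k where "k = i div int p"
  have ik: "k * int p \<le> i" "i < (k + 1) * int p"
    using p(1) by (simp_all add: k_def algebra_simps minus_mod_eq_mult_div [symmetric])
  let ?W = "{k * int p ..< (k + 1) * int p}"
  have W: "?W = {k * int p ..< k * int p + j} \<union> {k * int p + j ..< (k + 1) * int p}"
    using j by (auto simp: algebra_simps)
  have noq: "\<not> hole q z i'" if "i' \<in> ?W" for i'
    using oxtoby_step_window[OF z(1) _ i(1) that] ik i(2) by auto
  have "\<exists>i\<in>?W. hole p v i"
    using left[of p k] right[of p k] i(1) ik W by fastforce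
  moreover have "\<not> (\<exists>i\<in>?W. hole q v i)"
    using left[of q k] right[of q k] noq W by fastforce
  ultimately show ?thesis
    using z(2) zv unfolding proper_step_def by blast
qed

text \<open>A good point is first moved to the class of the Oxtoby point, whose cut has periodic margins,
  then mapped, and finally moved to the cut of the Oxtoby point of the image.\<close>

lemma local_conj_good_kernel:
  fixes X Y :: "(int \<Rightarrow> 'a) set"
  assumes p: "0 < p" "p dvd q" and fg: "local_conj r X Y f g"
    and X: "\<And>n z. z \<in> X \<Longrightarrow> translate n z \<in> X" and Y: "\<And>n z. z \<in> Y \<Longrightarrow> translate n z \<in> Y"
    and x: "oxtoby_step p q x" "\<And>i. \<bar>i\<bar> \<le> 2 * int r \<Longrightarrow> i \<in> Per p x"
    and y: "oxtoby_step p q y" "\<And>i. \<bar>i\<bar> \<le> 2 * int r \<Longrightarrow> i \<in> Per p y"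
    and skX: "\<And>z. z \<in> X \<Longrightarrow> \<exists>j. skeleton q z = skeleton q (translate j x)"
    and skY: "\<And>z. z \<in> Y \<Longrightarrow> \<exists>j. skeleton q z = skeleton q (translate j y)"
    and w: "w \<in> good p q X"
  shows "\<exists>v\<in>good p q Y. block_kernel p v = block_kernel p w"
proof -
  have f: "local_map r X f" and g: "local_map r Y g"
    and fX: "\<And>z. z \<in> X \<Longrightarrow> f z \<in> Y" and gf: "\<And>z. z \<in> X \<Longrightarrow> g (f z) = z"
    using fg by (auto simp: local_conj_def)
  obtain j0 where "skeleton q w = skeleton q (translate j0 x)"
    using skX w by (auto simp: good_def)
  from good_normalize[OF p x(1) w this] obtain n k where
    n: "block_kernel p (translate n w) = block_kernel p w"
       "skeleton q (translate n w) = skeleton q (translate (k * int p) x)" by blast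
  define z where "z = translate n w"
  have zX: "z \<in> X" using w X by (simp add: z_def good_def)
  have z: "oxtoby_step p q z" "proper_step p q z"
    using step_cong(1)[OF p(2) n(2)] oxtoby_step_translate[OF x(1)] w by (simp_all add: z_def good_def)
  have "skeleton p z = skeleton p x"
    using skeleton_coarsen[OF p(2) n(2)] skeleton_translate_mult[of p k x] by (simp add: z_def)
  \<comment> \<open>After normalization \<open>z\<close> has the p-skeleton of \<open>x\<close>, so
    the margin of \<open>x\<close> becomes a margin of \<open>z\<close>.\<close>
  then have zper: "i \<in> Per p z" if "\<bar>i\<bar> \<le> 2 * int r" for i
    using x(2)[OF that] skeleton_eq_Per by blast
  define u where "u = f z"
  have uY: "u \<in> Y" and gu: "g u = z" using fX gf zX by (simp_all add: u_def)
  have ku: "block_kernel p u = block_kernel p w"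
    using local_conj_kernel[OF fg zX zper] n(1) by (simp add: u_def z_def)
  obtain j1 where j1: "skeleton q u = skeleton q (translate j1 y)" using skY[OF uY] by blast
  \<comment> \<open>The cut of \<open>y\<close>, as seen in \<open>u\<close>, reduced to the first
    window.\<close>
  define j where "j = (- j1) mod int p"
  have j: "0 \<le> j" "j < int p" using p(1) by (simp_all add: j_def)
  have sk: "\<exists>k. skeleton q (translate (j + m * int p) u) = skeleton q (translate (k * int p) y)" for m
  proof -
    have "j + m * int p + j1 = (m - (- j1) div int p) * int p"
      unfolding j_def by (simp add: left_diff_distrib minus_div_mult_eq_mod [symmetric])
    then have "skeleton q (translate (j + m * int p) u) =
        skeleton q (translate ((m - (- j1) div int p) * int p) y)"
      using skeleton_translate_cong[OF j1, of "j + m * int p"] by (simp only: translate_translate)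
    then show ?thesis by blast
  qed
  have stepu: "oxtoby_step p q (translate (j + m * int p) u)" for m
    using sk[of m] step_cong(1)[OF p(2)] oxtoby_step_translate[OF y(1)] by metis
  have uper: "j + i \<in> Per p u" if "\<bar>i\<bar> \<le> int r" for i
  proof -
    obtain k where k: "skeleton q (translate j u) = skeleton q (translate (k * int p) y)"
      using sk[of 0] by auto
    have "skeleton p (translate j u) = skeleton p y"
      using skeleton_coarsen[OF p(2) k] skeleton_translate_mult[of p k y] by simp
    then have "i \<in> Per p (translate j u)" using y(2)[of i] that skeleton_eq_Per by fastforce
    then show ?thesis by (simp add: add.commute)
  qed
  have zu: "\<exists>i'. \<bar>i' - i\<bar> \<le> int r \<and> hole s u i'" if "hole s z i" for s i
    using local_map_hole[OF g uY, of s i] that gu by simp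
  have uz: "\<exists>i'. \<bar>i' - i\<bar> \<le> int r \<and> hole s z i'" if "hole s u i" for s i
    using local_map_hole[OF f zX, of s i] that by (simp add: u_def)
  \<comment> \<open>Margins of \<open>z\<close> at its cuts \<open>k * p\<close> and, next, of
    \<open>u\<close> at its cuts \<open>k * p + j\<close>. These are the ends of the intervals to
    which \<open>holes_between\<close> is applied; level \<open>q\<close> inherits them from level
    \<open>p\<close>.\<close>
  have mz: "\<not> hole s z i" if "s \<in> {p, q}" "\<bar>i - k * int p\<bar> \<le> int r" for s i k
  proof -
    have "i - k * int p \<in> Per p z" using that by (intro zper) linarith
    then show ?thesis using that(1) Per_dvd[OF p(2), of z] by (auto simp: hole_def)
  qed
  have mu: "\<not> hole s u i" if "s \<in> {p, q}" "\<bar>i - (k * int p + j)\<bar> \<le> int r" for s i k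
  proof -
    have "j + (i - (k * int p + j)) \<in> Per p u" using that by (intro uper)
    then have "i - k * int p \<in> Per p u" by (simp only: add_diff_cancel_left' diff_diff_eq2 diff_add_eq_diff_diff_swap) (simp add: algebra_simps)
    then show ?thesis using that(1) Per_dvd[OF p(2), of u] by (auto simp: hole_def)
  qed
  have left: "(\<exists>i\<in>{k * int p ..< k * int p + j}. hole s z i) \<longleftrightarrow>
      (\<exists>i\<in>{k * int p ..< k * int p + j}. hole s u i)" if "s \<in> {p, q}" for s k
    using mz[OF that] mu[OF that] by (intro holes_between[OF zu uz]) blast+
  have right: "(\<exists>i\<in>{k * int p + j ..< (k + 1) * int p}. hole s z i) \<longleftrightarrow>
      (\<exists>i\<in>{k * int p + j ..< (k + 1) * int p}. hole s u i)" if "s \<in> {p, q}" for s k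
    using mz[OF that] mu[OF that] by (intro holes_between[OF zu uz]) blast+
  have "oxtoby_step p q (translate j u)" using stepu[of 0] by simp
  then have "(\<forall>i\<in>{0..<j}. i \<in> Per p u) \<or> (\<forall>i\<in>{j..<int p}. i \<in> Per p u)"
    by (intro cut_in_gap[OF p j z _ left right])
  then obtain m where m: "block_kernel p (translate (j + m * int p) u) = block_kernel p u"
    using kernel_move_cut[OF j] by blast
  have "proper_step p q u"
    by (rule proper_step_transfer[OF p j z _ left right]) (use zu in blast)
  then have "translate (j + m * int p) u \<in> good p q Y"
    using stepu Y[OF uY] by (simp add: good_def)
  then show ?thesis using m ku by blast
qed

section \<open>Conjugacies are local maps\<close>

lemma subshift_compactin: "finite A \<Longrightarrow> subshift A X \<Longrightarrow> compactin (full_shift A) X"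
  using closedin_compact_space compact_space_full_shift by (auto simp: subshift_def)

lemma equivariant_translate:
  assumes X: "subshift A X" and f: "\<And>x. x \<in> X \<Longrightarrow> f (shift x) = shift (f x)" and z: "z \<in> X"
  shows "f (translate n z) = translate n (f z)"
proof -
  have s: "shift = translate 1" by (auto simp: shift_def translate_def fun_eq_iff)
  have pos: "f (translate (int k) z) = translate (int k) (f z)" if "z \<in> X" for k z
  proof (induction k)
    case (Suc k)
    have "f (translate 1 (translate (int k) z)) = translate 1 (f (translate (int k) z))"
      using f[OF subshift_translate[OF X that, of "int k"]] by (simp only: s)
    then show ?case using Suc by simp
  qed simp
  show ?thesis
  proof (cases "n \<ge> 0")
    case True
    then show ?thesis using pos[OF z, of "nat n"] by simp
  next
    case False
    have "f (translate (int (nat (- n))) (translate n z)) = translate (int (nat (- n))) (f (translate n z))"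
      by (intro pos subshift_translate[OF X z])
    then have "f z = translate (- n) (f (translate n z))" using False by simp
    then show ?thesis by simp
  qed
qed

text \<open>The Curtis-Hedlund-Lyndon argument: coordinate \<open>0\<close> of \<open>f\<close> is
  locally constant, compactness gives one radius for all points, and equivariance moves it to every
  coordinate.\<close>

lemma continuous_local_map:
  assumes A: "finite A" and X: "subshift A X"
    and f: "continuous_map (subtopology (full_shift A) X) (full_shift A) f"
    and eq: "\<And>x. x \<in> X \<Longrightarrow> f (shift x) = shift (f x)"
  shows "\<exists>r. local_map r X f"
proof -
  have XT: "X \<subseteq> topspace (full_shift A)" by (rule subshift_subset[OF X])
  have "\<exists>N. \<forall>w\<in>X. agree N z w \<longrightarrow> f w 0 = f z 0" if z: "z \<in> X" for z
  proof -
    let ?V = "{v \<in> topspace (full_shift A). v 0 = f z 0}"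
    have "openin (full_shift A) ?V"
      by (rule openin_full_shift_local[of 0]) (simp add: agree_def)
    then have "openin (subtopology (full_shift A) X) {w \<in> topspace (subtopology (full_shift A) X). f w \<in> ?V}"
      by (rule openin_continuous_map_preimage[OF f])
    then obtain U where U: "openin (full_shift A) U"
      "{w \<in> topspace (subtopology (full_shift A) X). f w \<in> ?V} = U \<inter> X"
      by (auto simp: openin_subtopology)
    have fT: "f w \<in> topspace (full_shift A)" if "w \<in> X" for w
      using f XT that by (auto simp: continuous_map_def)
    have inU: "w \<in> U \<longleftrightarrow> f w 0 = f z 0" if "w \<in> X" for w
      using U(2) that fT[OF that] XT by (auto simp: set_eq_iff)
    obtain N where "\<forall>w\<in>topspace (full_shift A). agree N z w \<longrightarrow> w \<in> U"
      using openin_full_shift_agree[OF U(1)] inU[OF z] by blast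
    then show ?thesis using inU XT by (intro exI[of _ N]) blast
  qed
  then obtain N where N: "\<And>z w. z \<in> X \<Longrightarrow> w \<in> X \<Longrightarrow> agree (N z) z w \<Longrightarrow> f w 0 = f z 0"
    by metis
  define C where "C = (\<lambda>z. {w \<in> topspace (full_shift A). agree (N z) z w})"
  have "\<forall>U\<in>C ` X. openin (full_shift A) U"
    unfolding C_def by (auto intro!: openin_full_shift_local simp: agree_def)
  moreover have "X \<subseteq> \<Union> (C ` X)" using XT by (auto simp: C_def agree_def)
  ultimately obtain \<F> where "finite \<F>" "\<F> \<subseteq> C ` X" "X \<subseteq> \<Union> \<F>"
    using subshift_compactin[OF A X] unfolding compactin_def by meson
  then obtain F where F: "finite F" "F \<subseteq> X" "X \<subseteq> \<Union> (C ` F)"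
    by (metis finite_subset_image)
  \<comment> \<open>Inserting \<open>0\<close> keeps \<open>Max\<close> meaningful when the finite
    subcover is empty.\<close>
  define r where "r = Max (insert 0 (N ` F))"
  have r: "f z 0 = f w 0" if zw: "z \<in> X" "w \<in> X" "agree r z w" for z w
  proof -
    obtain c where c: "c \<in> F" "z \<in> C c" using F zw by blast
    have "N c \<le> r" unfolding r_def using c F by (intro Max_ge) auto
    have "agree (N c) c w"
      using c(2) zw(3) \<open>N c \<le> r\<close> by (auto simp: C_def agree_def)
    moreover have "agree (N c) c z" using c(2) by (simp add: C_def)
    ultimately show ?thesis using N[of c] c F zw by (metis subsetD)
  qed
  have "local_map r X f"
    unfolding local_map_def
  proof (intro ballI allI impI)
    fix z w i j assume zw: "z \<in> X" "w \<in> X" and d: "\<forall>d. \<bar>d\<bar> \<le> int r \<longrightarrow> z (i + d) = w (j + d)"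
    have "f (translate i z) 0 = f (translate j w) 0"
      using d by (intro r subshift_translate[OF X] zw) (simp add: agree_def translate_apply add.commute)
    moreover have "f (translate i z) = translate i (f z)" "f (translate j w) = translate j (f w)"
      using equivariant_translate[OF X, of f] eq zw by blast+
    ultimately show "f z i = f w j" by (simp add: translate_apply)
  qed
  then show ?thesis by blast
qed

lemma continuous_map_full_shift:
  "continuous_map T (full_shift A) f \<longleftrightarrow> (\<forall>k. continuous_map T (discrete_topology A) (\<lambda>x. f x k))"
  by (simp only: full_shift_def continuous_map_componentwise_UNIV)

lemma local_map_continuous:
  assumes f: "local_map r X f" "\<And>z. z \<in> X \<Longrightarrow> f z \<in> Y"
    and X: "X \<subseteq> topspace (full_shift A)" and Y: "Y \<subseteq> topspace (full_shift A)"
  shows "continuous_map (subtopology (full_shift A) X) (subtopology (full_shift A) Y) f"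
proof -
  have "continuous_map (subtopology (full_shift A) X) (full_shift A) f"
    unfolding continuous_map_full_shift
  proof
    fix k
    show "continuous_map (subtopology (full_shift A) X) (discrete_topology A) (\<lambda>x. f x k)"
      unfolding continuous_map_def
    proof (intro conjI allI impI)
      show "(\<lambda>x. f x k) \<in> topspace (subtopology (full_shift A) X) \<rightarrow> topspace (discrete_topology A)"
        using f(2) Y by (auto simp: topspace_full_shift subset_iff)
      fix U assume "openin (discrete_topology A) U"
      let ?N = "r + nat \<bar>k\<bar>"
      \<comment> \<open>A union of cylinders around points of the preimage, hence open in the full
        shift. Windows of radius \<open>?N\<close> contain the \<open>r\<close>-window at
        \<open>k\<close>, so on \<open>X\<close> it cuts out exactly the preimage.\<close>
      let ?Q = "\<lambda>v. \<exists>z\<in>X. agree ?N z v \<and> f z k \<in> U"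
      have "openin (full_shift A) {v \<in> topspace (full_shift A). ?Q v}"
      proof (rule openin_full_shift_local[of ?N])
        fix x y :: "int \<Rightarrow> 'a" assume xy: "agree ?N x y" "?Q x"
        then show "?Q y" unfolding agree_def by metis
      qed
      moreover have "{x \<in> topspace (subtopology (full_shift A) X). f x k \<in> U} =
          {v \<in> topspace (full_shift A). ?Q v} \<inter> X"
      proof -
        have "f v k = f z k" if "z \<in> X" "v \<in> X" "agree ?N z v" for z v
          using that by (intro local_mapD[OF f(1)]) (auto simp: agree_def)
        then have 1: "f v k \<in> U" if "v \<in> X" "?Q v" for v
          using that by metis
        have 2: "?Q v" if "v \<in> X" "f v k \<in> U" for v
          using that by (intro bexI[of _ v]) (auto simp: agree_def)
        show ?thesis
        proof (intro set_eqI iffI)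
          fix v assume "v \<in> {x \<in> topspace (subtopology (full_shift A) X). f x k \<in> U}"
          then have "v \<in> X" "v \<in> topspace (full_shift A)" "f v k \<in> U" by simp_all
          with 2[of v] show "v \<in> {v \<in> topspace (full_shift A). ?Q v} \<inter> X" by blast
        next
          fix v assume "v \<in> {v \<in> topspace (full_shift A). ?Q v} \<inter> X"
          then have "v \<in> X" "v \<in> topspace (full_shift A)" "?Q v" by blast+
          with 1[of v] show "v \<in> {x \<in> topspace (subtopology (full_shift A) X). f x k \<in> U}" by simp
        qed
      qed
      ultimately show "openin (subtopology (full_shift A) X)
          {x \<in> topspace (subtopology (full_shift A) X). f x k \<in> U}"
        unfolding openin_subtopology by blast
    qed
  qed
  then show ?thesis using f(2) by (auto simp: continuous_map_in_subtopology)
qed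

lemma conjugate_iff_local_conj:
  assumes A: "finite A" and X: "subshift A X" and Y: "subshift A Y"
  shows "conjugate A X Y \<longleftrightarrow> (\<exists>r f g. local_conj r X Y f g)"
proof
  have XT: "topspace (subtopology (full_shift A) X) = X" "topspace (subtopology (full_shift A) Y) = Y"
    using subshift_subset[OF X] subshift_subset[OF Y] by auto
  assume "conjugate A X Y"
  then obtain f g where fg: "homeomorphic_maps (subtopology (full_shift A) X) (subtopology (full_shift A) Y) f g"
    and eq: "\<And>x. x \<in> X \<Longrightarrow> f (shift x) = shift (f x)"
    by (auto simp: conjugate_def homeomorphic_map_maps)
  have cont: "continuous_map (subtopology (full_shift A) X) (subtopology (full_shift A) Y) f"
    "continuous_map (subtopology (full_shift A) Y) (subtopology (full_shift A) X) g"
    and inv: "\<And>x. x \<in> X \<Longrightarrow> g (f x) = x" "\<And>y. y \<in> Y \<Longrightarrow> f (g y) = y"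
    using fg unfolding homeomorphic_maps_def XT by auto
  have fX: "f x \<in> Y" if "x \<in> X" for x
    using cont(1) that unfolding continuous_map_def XT by blast
  have gY: "g y \<in> X" if "y \<in> Y" for y
    using cont(2) that unfolding continuous_map_def XT by blast
  have eqg: "g (shift y) = shift (g y)" if "y \<in> Y" for y
  proof -
    have "shift (g y) \<in> X" using X gY[OF that] by (auto simp: subshift_def)
    moreover have "f (shift (g y)) = shift y" using eq[OF gY[OF that]] inv(2)[OF that] by simp
    ultimately show ?thesis using inv(1) by metis
  qed
  obtain r1 where r1: "local_map r1 X f"
    using continuous_local_map[OF A X, of f] eq cont(1) by (auto simp: continuous_map_in_subtopology)
  obtain r2 where r2: "local_map r2 Y g"
    using continuous_local_map[OF A Y, of g] eqg cont(2) by (auto simp: continuous_map_in_subtopology)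
  have mono: "local_map (max r1 r2) Z h" if "local_map r Z h" "r \<in> {r1, r2}" for r Z and h :: "(int \<Rightarrow> 'a) \<Rightarrow> int \<Rightarrow> 'a"
    unfolding local_map_def
  proof (intro ballI allI impI)
    fix z w i j assume "z \<in> Z" "w \<in> Z" "\<forall>d. \<bar>d\<bar> \<le> int (max r1 r2) \<longrightarrow> z (i + d) = w (j + d)"
    then show "h z i = h w j" using that(2) by (intro local_mapD[OF that(1)]) auto
  qed
  have "local_conj (max r1 r2) X Y f g"
    using mono[OF r1] mono[OF r2] fX gY inv by (simp add: local_conj_def)
  then show "\<exists>r f g. local_conj r X Y f g" by blast
next
  assume "\<exists>r f g. local_conj r X Y f g"
  then obtain r f g where fg: "local_map r X f" "local_map r Y g"
    "\<And>z. z \<in> X \<Longrightarrow> f z \<in> Y" "\<And>z. z \<in> X \<Longrightarrow> g (f z) = z"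
    "\<And>z. z \<in> Y \<Longrightarrow> g z \<in> X" "\<And>z. z \<in> Y \<Longrightarrow> f (g z) = z"
    by (auto simp: local_conj_def)
  have s: "shift x = translate 1 x" for x :: "int \<Rightarrow> 'a"
    by (auto simp: shift_def translate_def fun_eq_iff)
  have "homeomorphic_maps (subtopology (full_shift A) X) (subtopology (full_shift A) Y) f g"
    unfolding homeomorphic_maps_def
    using local_map_continuous[OF fg(1,3) subshift_subset[OF X] subshift_subset[OF Y]]
      local_map_continuous[OF fg(2,5) subshift_subset[OF Y] subshift_subset[OF X]] fg
    by auto
  moreover have "f (shift x) = shift (f x)" if "x \<in> X" for x
    unfolding s using local_map_translate[OF fg(1) that subshift_translate[OF X that]] .
  ultimately show "conjugate A X Y"
    unfolding conjugate_def homeomorphic_map_maps by blast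
qed

section \<open>Conjugacy as an equivalence relation\<close>

lemma local_map_compose:
  assumes f: "local_map r X f" "\<And>z. z \<in> X \<Longrightarrow> f z \<in> Y" and g: "local_map s Y g"
  shows "local_map (r + s) X (g \<circ> f)"
  unfolding local_map_def
proof (intro ballI allI impI)
  fix z w i j assume zw: "z \<in> X" "w \<in> X" "\<forall>d. \<bar>d\<bar> \<le> int (r + s) \<longrightarrow> z (i + d) = w (j + d)"
  have "f z (i + d) = f w (j + d)" if "\<bar>d\<bar> \<le> int s" for d
  proof (rule local_mapD[OF f(1) zw(1,2)])
    fix e assume "\<bar>e\<bar> \<le> int r"
    then show "z (i + d + e) = w (j + d + e)"
      using zw(3)[rule_format, of "d + e"] that by (simp add: add.assoc)
  qed
  then show "(g \<circ> f) z i = (g \<circ> f) w j"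
    using zw f(2) by (auto intro: local_mapD[OF g])
qed

lemma local_conj_refl: "local_conj 0 X X id id"
  unfolding local_conj_def local_map_def by (auto dest: spec[of _ 0])

lemma local_conj_trans:
  assumes "local_conj r X Y f g" "local_conj s Y Z f' g'"
  shows "local_conj (r + s) X Z (f' \<circ> f) (g \<circ> g')"
  using assms local_map_compose[of r X f Y s f'] local_map_compose[of s Z g' Y r g]
  by (simp add: local_conj_def add.commute)

lemma equiv_conjugacy_on:
  assumes "finite A" and G: "\<And>X. X \<in> G \<Longrightarrow> subshift A X"
  shows "equiv G (conjugacy_on A G)"
proof -
  have *: "(X, Y) \<in> conjugacy_on A G \<longleftrightarrow> X \<in> G \<and> Y \<in> G \<and> (\<exists>r f g. local_conj r X Y f g)" for X Y
    using conjugate_iff_local_conj[OF assms(1) G G, of X Y]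
    by (cases "X \<in> G"; cases "Y \<in> G") (simp_all add: conjugacy_on_def)
  show ?thesis
  proof (rule equivI)
    show "conjugacy_on A G \<subseteq> G \<times> G" by (auto simp: *)
    show "refl_on G (conjugacy_on A G)"
      using local_conj_refl by (auto simp: refl_on_def *)
    show "sym (conjugacy_on A G)"
      by (rule symI) (use local_conj_sym * in blast)
    show "trans (conjugacy_on A G)"
    proof (rule transI)
      fix X Y Z assume "(X, Y) \<in> conjugacy_on A G" "(Y, Z) \<in> conjugacy_on A G"
      then obtain r f g s f' g' where XZ: "X \<in> G" "Z \<in> G"
        and fg: "local_conj r X Y f g" "local_conj s Y Z f' g'"
        unfolding * by blast
      from local_conj_trans[OF fg] XZ show "(X, Z) \<in> conjugacy_on A G"
        unfolding * by blast
    qed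
  qed
qed

section \<open>Borel families of subshifts\<close>

text \<open>Missing \<open>C\<close> means lying inside an open set, which is a subbasic open
  condition of the Vietoris topology. Hitting is its complement in \<open>G\<close>.\<close>

lemma hit_closed_measurable:
  assumes A: "finite A" and G: "\<And>X. X \<in> G \<Longrightarrow> subshift A X" and C: "closedin (full_shift A) C"
  shows "{X \<in> G. X \<inter> C \<noteq> {}} \<in> sets (subshift_borel A G)"
proof -
  let ?V = "{K. compactin (full_shift A) K \<and> K \<subseteq> topspace (full_shift A) - C}"
  have "openin (vietoris (full_shift A)) ?V"
    unfolding vietoris_def using C by (intro topology_generated_by_Basis UnI1) (auto simp: closedin_def)
  then have "?V \<in> sets (borel_of (vietoris (full_shift A)))"
    unfolding sets_borel_of by (intro sigma_sets.Basic) simp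
  then have "G \<inter> ?V \<in> sets (subshift_borel A G)"
    unfolding subshift_borel_def sets_restrict_space by (rule imageI)
  then have "space (subshift_borel A G) - G \<inter> ?V \<in> sets (subshift_borel A G)"
    by (rule sets.compl_sets)
  moreover have "space (subshift_borel A G) - G \<inter> ?V = {X \<in> G. X \<inter> C \<noteq> {}}"
    using subshift_compactin[OF A G] subshift_subset[OF G] space_subshift_borel[OF A G] by auto
  ultimately show ?thesis by simp
qed

lemma hit_fsigma_measurable:
  assumes A: "finite A" and G: "\<And>X. X \<in> G \<Longrightarrow> subshift A X" and S: "fsigma_in (full_shift A) S"
  shows "{X \<in> G. X \<inter> S \<noteq> {}} \<in> sets (subshift_borel A G)"
proof -
  obtain C where C: "\<And>n::nat. closedin (full_shift A) (C n)" "\<Union> (range C) = S"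
    using S by (auto simp: fsigma_in_ascending)
  have "(\<Union>n. {X \<in> G. X \<inter> C n \<noteq> {}}) \<in> sets (subshift_borel A G)"
    by (intro sets.countable_nat_UN image_subsetI hit_closed_measurable[OF A G C(1)])
  moreover have "(\<Union>n. {X \<in> G. X \<inter> C n \<noteq> {}}) = {X \<in> G. X \<inter> S \<noteq> {}}"
    unfolding C(2)[symmetric] by blast
  ultimately show ?thesis by simp
qed

text \<open>Being a hole is an open condition and not being one is closed. F-sigma sets accommodate
  both, and they allow countable existential quantifiers and finite conjunctions.\<close>

abbreviation fsigma_pred :: "'a set \<Rightarrow> ((int \<Rightarrow> 'a) \<Rightarrow> bool) \<Rightarrow> bool" where
  "fsigma_pred A Q \<equiv> fsigma_in (full_shift A) {z \<in> topspace (full_shift A). Q z}"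

lemma fsigma_pred_local:
  assumes "\<And>x y. agree N x y \<Longrightarrow> Q x \<Longrightarrow> Q y"
  shows "fsigma_pred A Q"
  by (rule closed_imp_fsigma_in[OF closedin_full_shift_local[OF assms]])

lemma fsigma_pred_conj:
  assumes "fsigma_pred A P" "fsigma_pred A Q"
  shows "fsigma_pred A (\<lambda>z. P z \<and> Q z)"
proof -
  have "{z \<in> topspace (full_shift A). P z \<and> Q z} =
      {z \<in> topspace (full_shift A). P z} \<inter> {z \<in> topspace (full_shift A). Q z}" by auto
  then show ?thesis using fsigma_in_Int[OF assms] by simp
qed

lemma fsigma_pred_disj:
  assumes "fsigma_pred A P" "fsigma_pred A Q"
  shows "fsigma_pred A (\<lambda>z. P z \<or> Q z)"
proof -
  have "{z \<in> topspace (full_shift A). P z \<or> Q z} =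
      {z \<in> topspace (full_shift A). P z} \<union> {z \<in> topspace (full_shift A). Q z}" by auto
  then show ?thesis using fsigma_in_Un[OF assms] by simp
qed

lemma fsigma_pred_ex:
  assumes "\<And>i::'i::countable. fsigma_pred A (P i)"
  shows "fsigma_pred A (\<lambda>z. \<exists>i. P i z)"
proof -
  have "{z \<in> topspace (full_shift A). \<exists>i. P i z} = \<Union> (range (\<lambda>i. {z \<in> topspace (full_shift A). P i z}))"
    by auto
  moreover have "fsigma_in (full_shift A) (\<Union> (range (\<lambda>i. {z \<in> topspace (full_shift A). P i z})))"
    by (rule fsigma_in_Union) (use assms in auto)
  ultimately show ?thesis by simp
qed

lemma fsigma_pred_finite_ball:
  assumes "finite I" "\<And>i. i \<in> I \<Longrightarrow> fsigma_pred A (P i)"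
  shows "fsigma_pred A (\<lambda>z. \<forall>i\<in>I. P i z)"
  using assms
proof (induction I rule: finite_induct)
  case (insert i I)
  have "fsigma_pred A (\<lambda>z. P i z \<and> (\<forall>i\<in>I. P i z))"
    using insert by (intro fsigma_pred_conj) auto
  then show ?case by simp
qed simp

section \<open>F-sigma conditions for holes and good points\<close>

lemma fsigma_pred_hole: "fsigma_pred A (\<lambda>z. hole p z i)"
proof -
  have "fsigma_pred A (\<lambda>z. z i \<noteq> z (i + k * int p))" for k
    by (rule fsigma_pred_local[of "nat (\<bar>i\<bar> + \<bar>i + k * int p\<bar>)"]) (auto simp: agree_def)
  from fsigma_pred_ex[OF this] show ?thesis by (simp add: hole_def Per_def)
qed

lemma fsigma_pred_not_hole: "fsigma_pred A (\<lambda>z. \<not> hole p z i)"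
proof (rule closed_imp_fsigma_in)
  have "closedin (full_shift A) (\<Inter>k\<in>UNIV. {z \<in> topspace (full_shift A). z i = z (i + k * int p)})"
  proof (intro closedin_INT)
    fix k
    show "closedin (full_shift A) {z \<in> topspace (full_shift A). z i = z (i + k * int p)}"
      by (rule closedin_full_shift_local[of "nat (\<bar>i\<bar> + \<bar>i + k * int p\<bar>)"]) (auto simp: agree_def)
  qed simp
  moreover have "(\<Inter>k\<in>UNIV. {z \<in> topspace (full_shift A). z i = z (i + k * int p)}) =
      {z \<in> topspace (full_shift A). \<not> hole p z i}"
    by (auto simp: hole_def Per_def)
  ultimately show "closedin (full_shift A) {z \<in> topspace (full_shift A). \<not> hole p z i}" by simp
qed

text \<open>Replaces the quantifier over all windows by a finite one, as required for F-sigma sets.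
  Translation by \<open>q * p\<close>, that is by \<open>q\<close> windows, preserves p-holes and
  q-holes alike.\<close>

lemma oxtoby_step_finite:
  assumes "p dvd q" "0 < q"
  shows "oxtoby_step p q x \<longleftrightarrow> (\<forall>k\<in>{0..<int q}.
    (\<forall>i\<in>{k * int p ..< (k + 1) * int p}. \<not> hole q x i) \<or>
    (\<forall>i\<in>{k * int p ..< (k + 1) * int p}. \<not> hole p x i \<or> hole q x i))"
  (is "_ \<longleftrightarrow> ?R")
proof
  assume "oxtoby_step p q x"
  then show ?R unfolding oxtoby_step_def by blast
next
  assume R: ?R
  show "oxtoby_step p q x"
    unfolding oxtoby_step_def
  proof (intro allI impI ballI)
    fix k i assume "\<exists>i\<in>{k * int p..<(k + 1) * int p}. hole q x i"
      and i: "i \<in> {k * int p..<(k + 1) * int p}" "hole p x i"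
    then obtain i' where i': "i' \<in> {k * int p..<(k + 1) * int p}" "hole q x i'" by blast
    define c where "c = k div int q"
    define l where "l = k mod int q"
    have k: "k = l + c * int q" by (simp add: c_def l_def)
    have l: "l \<in> {0..<int q}" using assms(2) by (simp add: l_def)
    have w: "m - c * int q * int p \<in> {l * int p..<(l + 1) * int p}"
      if "m \<in> {k * int p..<(k + 1) * int p}" for m
      using that by (auto simp: k algebra_simps)
    have hp: "hole p x (m - c * int q * int p) \<longleftrightarrow> hole p x m" for m
      using hole_add[of p x m "- (c * int q)"] by simp
    have hq: "hole q x (m - c * int q * int p) \<longleftrightarrow> hole q x m" for m
      using hole_add[of q x m "- (c * int p)"] by (simp add: ac_simps)
    show "hole q x i"
      using R[rule_format, OF l] w[OF i(1)] w[OF i'(1)] i(2) i'(2) hp hq by blast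
  qed
qed

abbreviation square :: "nat \<Rightarrow> (int \<times> int) set" where
  "square N \<equiv> {- int N..int N} \<times> {- int N..int N}"

lemma kernel_box_agree:
  assumes "agree (p + N * p) x y"
  shows "block_kernel p x \<inter> square N = block_kernel p y \<inter> square N"
proof -
  have "x (i + k * int p) = y (i + k * int p)" if "i \<in> {0..<int p}" "k \<in> {- int N..int N}" for i k
  proof -
    have "\<bar>k * int p\<bar> \<le> int N * int p" using that(2) by (auto simp: abs_mult intro!: mult_right_mono)
    moreover have "\<bar>i\<bar> \<le> int p" using that(1) by simp
    ultimately have "\<bar>i + k * int p\<bar> \<le> int p + int N * int p"
      using abs_triangle_ineq[of i "k * int p"] by linarith
    then show ?thesis using assms by (simp add: agree_def)
  qed
  then show ?thesis unfolding block_kernel_def by auto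
qed

lemma fsigma_pred_good:
  assumes "p dvd q" "0 < q"
  shows "fsigma_pred A (\<lambda>z. oxtoby_step p q z \<and> proper_step p q z \<and> block_kernel p z \<inter> square N = \<kappa>)"
proof -
  have "fsigma_pred A (\<lambda>z. block_kernel p z \<inter> square N = \<kappa>)"
    by (rule fsigma_pred_local[of "p + N * p"]) (drule kernel_box_agree, simp)
  moreover have "fsigma_pred A (proper_step p q)"
    unfolding proper_step_def
    by (intro fsigma_pred_conj fsigma_pred_ex fsigma_pred_hole fsigma_pred_not_hole)
  moreover have "fsigma_pred A (oxtoby_step p q)"
    unfolding oxtoby_step_finite[OF assms]
    by (intro fsigma_pred_finite_ball fsigma_pred_disj fsigma_pred_hole fsigma_pred_not_hole) auto
  ultimately show ?thesis by (intro fsigma_pred_conj)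
qed

text \<open>The bridge to measurability: each question about the kernel set of \<open>X\<close>
  becomes the question whether \<open>X\<close> meets a fixed set.\<close>

lemma good_kernel_hit:
  assumes "X \<subseteq> topspace (full_shift A)"
  shows "\<kappa> \<in> (\<lambda>z. block_kernel p z \<inter> B) ` good p q X \<longleftrightarrow>
    X \<inter> {z \<in> topspace (full_shift A). oxtoby_step p q z \<and> proper_step p q z \<and> block_kernel p z \<inter> B = \<kappa>} \<noteq> {}"
  using assms by (auto simp: good_def)


section \<open>Conjugacy is Borel\<close>

definition block_map :: "nat \<Rightarrow> ((int \<Rightarrow> 'a) \<Rightarrow> 'a) \<Rightarrow> (int \<Rightarrow> 'a) \<Rightarrow> int \<Rightarrow> 'a" where
  "block_map r \<phi> z = (\<lambda>i. \<phi> (\<lambda>d\<in>{- int r..int r}. z (i + d)))"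

definition words :: "'a set \<Rightarrow> nat \<Rightarrow> (int \<Rightarrow> 'a) set" where
  "words A r = {- int r..int r} \<rightarrow>\<^sub>E A"

lemma finite_words: "finite A \<Longrightarrow> finite (words A r)"
  unfolding words_def by (intro finite_PiE) auto

lemma finite_rules: "finite A \<Longrightarrow> finite (words A r \<rightarrow>\<^sub>E A)"
  by (intro finite_PiE finite_words)

lemma block_map_agree:
  assumes "agree (r + nat \<bar>i\<bar>) x y"
  shows "block_map r \<phi> x i = block_map r \<phi> y i"
  unfolding block_map_def using assms
  by (intro arg_cong[where f = \<phi>] restrict_ext) (auto simp: agree_def)

lemma local_map_block_map: "local_map r X (block_map r \<phi>)"
  unfolding local_map_def block_map_def
  by (intro ballI allI impI arg_cong[where f = \<phi>] restrict_ext) auto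

lemma block_map_in_topspace:
  assumes "\<phi> \<in> words A r \<rightarrow>\<^sub>E A" "z \<in> topspace (full_shift A)"
  shows "block_map r \<phi> z \<in> topspace (full_shift A)"
proof -
  have "(\<lambda>d\<in>{- int r..int r}. z (i + d)) \<in> words A r" for i
    using assms(2) by (auto simp: words_def topspace_full_shift)
  then show ?thesis using assms(1) by (auto simp: topspace_full_shift block_map_def)
qed

lemma local_map_eq_block_map:
  assumes f: "local_map r X f" and X: "subshift A X" and fX: "\<And>z. z \<in> X \<Longrightarrow> f z \<in> topspace (full_shift A)"
    and ne: "X \<noteq> {}"
  shows "\<exists>\<phi>\<in>words A r \<rightarrow>\<^sub>E A. \<forall>z\<in>X. f z = block_map r \<phi> z"
proof -
  define R where "R = (\<lambda>z :: int \<Rightarrow> 'a. \<lambda>d\<in>{- int r..int r}. z d)"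
  \<comment> \<open>The choice takes a point of \<open>X\<close> showing the word \<open>u\<close>
    at the origin, and any point of \<open>X\<close> when \<open>u\<close> does not occur there, so
    that \<open>\<phi>\<close> has values in \<open>A\<close> on all words.\<close>
  define \<phi> where "\<phi> = (\<lambda>u\<in>words A r. f (SOME z. z \<in> X \<and> (R z = u \<or> u \<notin> R ` X)) 0)"
  have ex: "\<exists>z. z \<in> X \<and> (R z = u \<or> u \<notin> R ` X)" for u
    using ne by (cases "u \<in> R ` X") auto
  have "\<phi> \<in> words A r \<rightarrow>\<^sub>E A"
    unfolding \<phi>_def using fX someI_ex[OF ex] by (auto simp: topspace_full_shift)
  moreover have "f z = block_map r \<phi> z" if z: "z \<in> X" for z
  proof
    fix i
    define u where "u = R (translate i z)"
    define c where "c = (SOME z. z \<in> X \<and> (R z = u \<or> u \<notin> R ` X))"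
    have tz: "translate i z \<in> X" by (rule subshift_translate[OF X z])
    have c: "c \<in> X" "R c = u"
      using someI_ex[OF ex[of u]] tz unfolding c_def[symmetric] by (auto simp: u_def)
    have uW: "u \<in> words A r"
      using subshift_subset[OF X] tz by (auto simp: u_def R_def words_def topspace_full_shift)
    have "u = (\<lambda>d\<in>{- int r..int r}. z (i + d))"
      unfolding u_def R_def by (rule restrict_ext) (simp add: translate_apply add.commute)
    then have "block_map r \<phi> z i = f c 0"
      using uW by (simp add: block_map_def \<phi>_def c_def)
    also have "f c 0 = f z i"
    proof (rule local_mapD[OF f c(1) z])
      fix d :: int assume "\<bar>d\<bar> \<le> int r"
      then have "R c d = c d" "u d = z (i + d)" by (auto simp: R_def u_def translate_apply add.commute)
      then show "c (0 + d) = z (i + d)" using c(2) by simp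
    qed
    finally show "f z i = block_map r \<phi> z i" by simp
  qed
  ultimately show ?thesis by blast
qed

text \<open>For each radius only finitely many pairs of rules remain, which turns conjugacy into a
  countable union.\<close>

lemma local_conj_block_map:
  assumes fg: "local_conj r X Y f g" and X: "subshift A X" and Y: "subshift A Y" and ne: "X \<noteq> {}"
  shows "\<exists>\<phi>\<in>words A r \<rightarrow>\<^sub>E A. \<exists>\<psi>\<in>words A r \<rightarrow>\<^sub>E A. local_conj r X Y (block_map r \<phi>) (block_map r \<psi>)"
proof -
  have l: "local_map r X f" "local_map r Y g" and fX: "\<And>z. z \<in> X \<Longrightarrow> f z \<in> Y"
    and gY: "\<And>z. z \<in> Y \<Longrightarrow> g z \<in> X" and inv: "\<And>z. z \<in> X \<Longrightarrow> g (f z) = z" "\<And>z. z \<in> Y \<Longrightarrow> f (g z) = z"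
    using fg by (auto simp: local_conj_def)
  have "Y \<noteq> {}" using fX ne by blast
  have fT: "f z \<in> topspace (full_shift A)" if "z \<in> X" for z
    using fX[OF that] subshift_subset[OF Y] by blast
  have gT: "g z \<in> topspace (full_shift A)" if "z \<in> Y" for z
    using gY[OF that] subshift_subset[OF X] by blast
  obtain \<psi> where \<psi>: "\<psi> \<in> words A r \<rightarrow>\<^sub>E A" "\<And>z. z \<in> Y \<Longrightarrow> g z = block_map r \<psi> z"
    using local_map_eq_block_map[OF l(2) Y gT \<open>Y \<noteq> {}\<close>] by metis
  obtain \<phi> where \<phi>: "\<phi> \<in> words A r \<rightarrow>\<^sub>E A" "\<And>z. z \<in> X \<Longrightarrow> f z = block_map r \<phi> z"
    using local_map_eq_block_map[OF l(1) X fT ne] by metis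
  have "local_conj r X Y (block_map r \<phi>) (block_map r \<psi>)"
    unfolding local_conj_def
    using fX gY inv by (auto simp: local_map_block_map \<phi>(2)[symmetric] \<psi>(2)[symmetric])
  then show ?thesis using \<phi>(1) \<psi>(1) by blast
qed

lemma closedin_agree:
  assumes "closedin (full_shift A) Y" "v \<in> topspace (full_shift A)" "\<And>N. \<exists>w\<in>Y. agree N v w"
  shows "v \<in> Y"
proof (rule ccontr)
  assume "v \<notin> Y"
  then obtain N where N: "\<forall>w\<in>topspace (full_shift A). agree N v w \<longrightarrow> w \<in> topspace (full_shift A) - Y"
    using openin_full_shift_agree[of A "topspace (full_shift A) - Y" v] assms(1,2)
    by (auto simp: closedin_def)
  then show False using assms(3)[of N] closedin_subset[OF assms(1)] by blast
qed

text \<open>Since \<open>Y\<close> is closed, \<open>f z\<close> belongs to it once each central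
  word of \<open>f z\<close> occurs centrally in some point of \<open>Y\<close>. The quantifier over
  points thus becomes countably many hitting conditions.\<close>

lemma maps_into_iff:
  assumes Y: "closedin (full_shift A) Y" and f: "\<And>z. z \<in> X \<Longrightarrow> f z \<in> topspace (full_shift A)"
    and X: "X \<subseteq> topspace (full_shift A)"
  shows "(\<forall>z\<in>X. f z \<in> Y) \<longleftrightarrow> (\<forall>N. \<forall>u\<in>words A N.
     X \<inter> {z \<in> topspace (full_shift A). \<forall>i\<in>{- int N..int N}. f z i = u i} \<noteq> {} \<longrightarrow>
     Y \<inter> {z \<in> topspace (full_shift A). \<forall>i\<in>{- int N..int N}. z i = u i} \<noteq> {})" (is "?L \<longleftrightarrow> ?R")
proof
  assume ?L
  then show ?R using closedin_subset[OF Y] by blast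
next
  assume R: ?R
  show ?L
  proof
    fix z assume z: "z \<in> X"
    show "f z \<in> Y"
    proof (rule closedin_agree[OF Y f[OF z]])
      fix N
      define u where "u = restrict (f z) {- int N..int N}"
      have "u \<in> words A N" using f[OF z] by (auto simp: u_def words_def topspace_full_shift)
      moreover have "X \<inter> {z \<in> topspace (full_shift A). \<forall>i\<in>{- int N..int N}. f z i = u i} \<noteq> {}"
        using z X by (auto simp: u_def)
      ultimately have "Y \<inter> {z \<in> topspace (full_shift A). \<forall>i\<in>{- int N..int N}. z i = u i} \<noteq> {}"
        using R by blast
      then obtain w where w: "w \<in> Y" "\<forall>i\<in>{- int N..int N}. w i = u i" by blast
      have "f z i = w i" if "\<bar>i\<bar> \<le> int N" for i
      proof -
        have "i \<in> {- int N..int N}" using that by auto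
        then show ?thesis using bspec[OF w(2)] by (simp add: u_def)
      qed
      then show "\<exists>w\<in>Y. agree N (f z) w"
        using w(1) by (auto simp: agree_def)
    qed
  qed
qed

section \<open>Measurable conditions on pairs of subshifts\<close>

context
  fixes A :: "'a set" and G :: "(int \<Rightarrow> 'a) set set"
  assumes A: "finite A" and G: "\<And>X. X \<in> G \<Longrightarrow> subshift A X"
begin

abbreviation "pair_borel \<equiv> subshift_borel A G \<Otimes>\<^sub>M subshift_borel A G"

lemma space_pair: "space pair_borel = G \<times> G"
  using space_subshift_borel[OF A G] by (simp add: space_pair_measure)

lemma pair_hit_fst:
  assumes "fsigma_in (full_shift A) S"
  shows "{P \<in> space pair_borel. fst P \<inter> S \<noteq> {}} \<in> sets pair_borel"
proof -
  have "{X \<in> G. X \<inter> S \<noteq> {}} \<times> space (subshift_borel A G) \<in> sets pair_borel"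
    by (intro pair_measureI hit_fsigma_measurable[OF A G assms] sets.top)
  moreover have "{X \<in> G. X \<inter> S \<noteq> {}} \<times> space (subshift_borel A G) = {P \<in> space pair_borel. fst P \<inter> S \<noteq> {}}"
    using space_subshift_borel[OF A G] by (auto simp: space_pair)
  ultimately show ?thesis by simp
qed

lemma pair_hit_snd:
  assumes "fsigma_in (full_shift A) S"
  shows "{P \<in> space pair_borel. snd P \<inter> S \<noteq> {}} \<in> sets pair_borel"
proof -
  have "space (subshift_borel A G) \<times> {X \<in> G. X \<inter> S \<noteq> {}} \<in> sets pair_borel"
    by (intro pair_measureI hit_fsigma_measurable[OF A G assms] sets.top)
  moreover have "space (subshift_borel A G) \<times> {X \<in> G. X \<inter> S \<noteq> {}} = {P \<in> space pair_borel. snd P \<inter> S \<noteq> {}}"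
    using space_subshift_borel[OF A G] by (auto simp: space_pair)
  ultimately show ?thesis by simp
qed

lemma fsigma_pred_block_map:
  "fsigma_pred A (\<lambda>z. \<forall>i\<in>{- int N..int N}. block_map r \<phi> z i = u i)"
proof (rule fsigma_pred_local[of "r + N"])
  fix x y :: "int \<Rightarrow> 'a" assume xy: "agree (r + N) x y" "\<forall>i\<in>{- int N..int N}. block_map r \<phi> x i = u i"
  have "block_map r \<phi> x i = block_map r \<phi> y i" if "i \<in> {- int N..int N}" for i
    using that by (intro block_map_agree agree_mono[OF xy(1)]) auto
  then show "\<forall>i\<in>{- int N..int N}. block_map r \<phi> y i = u i" using xy(2) by metis
qed

lemma fsigma_pred_word: "fsigma_pred A (\<lambda>z. \<forall>i\<in>{- int N..int N}. z i = u i)"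
proof (rule fsigma_pred_local[of N])
  fix x y :: "int \<Rightarrow> 'a" assume xy: "agree N x y" "\<forall>i\<in>{- int N..int N}. x i = u i"
  have "x i = y i" if "i \<in> {- int N..int N}" for i using xy(1) that by (auto simp: agree_def)
  then show "\<forall>i\<in>{- int N..int N}. y i = u i" using xy(2) by metis
qed

lemma fsigma_pred_not_inverse:
  "fsigma_pred A (\<lambda>z. \<exists>i. block_map r \<psi> (block_map r \<phi> z) i \<noteq> z i)"
proof (rule fsigma_pred_ex)
  fix i
  show "fsigma_pred A (\<lambda>z. block_map r \<psi> (block_map r \<phi> z) i \<noteq> z i)"
  proof (rule fsigma_pred_local[of "r + (r + nat \<bar>i\<bar>)"])
    fix x y :: "int \<Rightarrow> 'a" assume xy: "agree (r + (r + nat \<bar>i\<bar>)) x y"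
    have "agree (r + nat \<bar>i\<bar>) (block_map r \<phi> x) (block_map r \<phi> y)"
      unfolding agree_def by (intro allI impI block_map_agree agree_mono[OF xy]) auto
    then have "block_map r \<psi> (block_map r \<phi> x) i = block_map r \<psi> (block_map r \<phi> y) i"
      by (rule block_map_agree)
    moreover have "x i = y i" using xy by (simp add: agree_def)
    ultimately show "block_map r \<psi> (block_map r \<phi> x) i \<noteq> x i \<Longrightarrow> block_map r \<psi> (block_map r \<phi> y) i \<noteq> y i"
      by simp
  qed
qed

lemma measurable_maps_into:
  assumes \<phi>: "\<phi> \<in> words A r \<rightarrow>\<^sub>E A"
  shows "{P \<in> space pair_borel. \<forall>z\<in>fst P. block_map r \<phi> z \<in> snd P} \<in> sets pair_borel"
    and "{P \<in> space pair_borel. \<forall>z\<in>snd P. block_map r \<phi> z \<in> fst P} \<in> sets pair_borel"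
proof -
  have G': "X \<subseteq> topspace (full_shift A)" "closedin (full_shift A) X" if "X \<in> G" for X
    using subshift_subset[OF G[OF that]] G[OF that] by (auto simp: subshift_def)
  have iff: "(\<forall>z\<in>X. block_map r \<phi> z \<in> Y) \<longleftrightarrow> (\<forall>N. \<forall>u\<in>words A N.
     X \<inter> {z \<in> topspace (full_shift A). \<forall>i\<in>{- int N..int N}. block_map r \<phi> z i = u i} \<noteq> {} \<longrightarrow>
     Y \<inter> {z \<in> topspace (full_shift A). \<forall>i\<in>{- int N..int N}. z i = u i} \<noteq> {})"
    if "X \<in> G" "Y \<in> G" for X Y
    by (rule maps_into_iff[OF G'(2)[OF that(2)] _ G'(1)[OF that(1)]])
      (use block_map_in_topspace[OF \<phi>] G'(1)[OF that(1)] in blast)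
  have 1: "{P \<in> space pair_borel. \<forall>N. \<forall>u\<in>words A N.
     fst P \<inter> {z \<in> topspace (full_shift A). \<forall>i\<in>{- int N..int N}. block_map r \<phi> z i = u i} \<noteq> {} \<longrightarrow>
     snd P \<inter> {z \<in> topspace (full_shift A). \<forall>i\<in>{- int N..int N}. z i = u i} \<noteq> {}} \<in> sets pair_borel"
    by (intro sets.sets_Collect_countable_All sets.sets_Collect_finite_All sets.sets_Collect_imp
        finite_words A pair_hit_fst pair_hit_snd fsigma_pred_block_map fsigma_pred_word)
  have 2: "{P \<in> space pair_borel. \<forall>N. \<forall>u\<in>words A N.
     snd P \<inter> {z \<in> topspace (full_shift A). \<forall>i\<in>{- int N..int N}. block_map r \<phi> z i = u i} \<noteq> {} \<longrightarrow>
     fst P \<inter> {z \<in> topspace (full_shift A). \<forall>i\<in>{- int N..int N}. z i = u i} \<noteq> {}} \<in> sets pair_borel"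
    by (intro sets.sets_Collect_countable_All sets.sets_Collect_finite_All sets.sets_Collect_imp
        finite_words A pair_hit_fst pair_hit_snd fsigma_pred_block_map fsigma_pred_word)
  show "{P \<in> space pair_borel. \<forall>z\<in>fst P. block_map r \<phi> z \<in> snd P} \<in> sets pair_borel"
    by (rule back_subst[of "\<lambda>S. S \<in> sets pair_borel", OF 1], rule Collect_cong,
        rule conj_cong[OF refl], rule iff[symmetric]) (auto simp: space_pair)
  show "{P \<in> space pair_borel. \<forall>z\<in>snd P. block_map r \<phi> z \<in> fst P} \<in> sets pair_borel"
    by (rule back_subst[of "\<lambda>S. S \<in> sets pair_borel", OF 2], rule Collect_cong,
        rule conj_cong[OF refl], rule iff[symmetric]) (auto simp: space_pair)
qed

lemma measurable_local_conj_block_map: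
  assumes "\<phi> \<in> words A r \<rightarrow>\<^sub>E A" "\<psi> \<in> words A r \<rightarrow>\<^sub>E A"
  shows "{P \<in> space pair_borel. local_conj r (fst P) (snd P) (block_map r \<phi>) (block_map r \<psi>)} \<in> sets pair_borel"
proof -
  let ?I = "\<lambda>\<phi> \<psi>. {z \<in> topspace (full_shift A). \<exists>i. block_map r \<psi> (block_map r \<phi> z) i \<noteq> z i}"
  have inv: "X \<inter> ?I \<phi> \<psi> = {} \<longleftrightarrow> (\<forall>z\<in>X. block_map r \<psi> (block_map r \<phi> z) = z)" if "X \<in> G" for X \<phi> \<psi>
    using subshift_subset[OF G[OF that]] by (auto simp: fun_eq_iff)
  let ?S = "{P \<in> space pair_borel. ((\<forall>z\<in>fst P. block_map r \<phi> z \<in> snd P) \<and> \<not> fst P \<inter> ?I \<phi> \<psi> \<noteq> {}) \<and>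
      ((\<forall>z\<in>snd P. block_map r \<psi> z \<in> fst P) \<and> \<not> snd P \<inter> ?I \<psi> \<phi> \<noteq> {})}"
  have "?S \<in> sets pair_borel"
    by (intro sets.sets_Collect_conj sets.sets_Collect_neg measurable_maps_into assms
        pair_hit_fst pair_hit_snd fsigma_pred_not_inverse)
  moreover have "?S = {P \<in> space pair_borel. local_conj r (fst P) (snd P) (block_map r \<phi>) (block_map r \<psi>)}"
  proof (intro Collect_cong conj_cong refl)
    fix P assume "P \<in> space pair_borel"
    then have P: "fst P \<in> G" "snd P \<in> G" by (auto simp: space_pair)
    show "((\<forall>z\<in>fst P. block_map r \<phi> z \<in> snd P) \<and> \<not> fst P \<inter> ?I \<phi> \<psi> \<noteq> {}) \<and>
        ((\<forall>z\<in>snd P. block_map r \<psi> z \<in> fst P) \<and> \<not> snd P \<inter> ?I \<psi> \<phi> \<noteq> {}) \<longleftrightarrow>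
      local_conj r (fst P) (snd P) (block_map r \<phi>) (block_map r \<psi>)"
      unfolding not_not inv[OF P(1)] inv[OF P(2)] local_conj_def
      by (simp add: local_map_block_map ball_conj_distrib)
  qed
  ultimately show ?thesis by simp
qed

lemma conjugacy_on_measurable:
  assumes ne: "{} \<notin> G"
  shows "conjugacy_on A G \<in> sets pair_borel"
proof -
  let ?W = "\<lambda>r. words A r \<rightarrow>\<^sub>E A"
  let ?C = "\<lambda>r \<phi> \<psi>. {P \<in> space pair_borel. local_conj r (fst P) (snd P) (block_map r \<phi>) (block_map r \<psi>)}"
  have "(\<Union>r. \<Union>\<phi>\<in>?W r. \<Union>\<psi>\<in>?W r. ?C r \<phi> \<psi>) \<in> sets pair_borel"
    by (intro sets.countable_nat_UN image_subsetI sets.finite_UN finite_rules A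
        measurable_local_conj_block_map)
  moreover have "(\<Union>r. \<Union>\<phi>\<in>?W r. \<Union>\<psi>\<in>?W r. ?C r \<phi> \<psi>) = conjugacy_on A G"
  proof (intro set_eqI)
    fix P :: "(int \<Rightarrow> 'a) set \<times> (int \<Rightarrow> 'a) set"
    obtain X Y where P: "P = (X, Y)" by force
    have "P \<in> (\<Union>r. \<Union>\<phi>\<in>?W r. \<Union>\<psi>\<in>?W r. ?C r \<phi> \<psi>) \<longleftrightarrow> X \<in> G \<and> Y \<in> G \<and>
        (\<exists>r. \<exists>\<phi>\<in>?W r. \<exists>\<psi>\<in>?W r. local_conj r X Y (block_map r \<phi>) (block_map r \<psi>))"
      by (simp add: P space_pair)
    also have "\<dots> \<longleftrightarrow> X \<in> G \<and> Y \<in> G \<and> conjugate A X Y"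
    proof (intro conj_cong refl)
      assume XY: "X \<in> G" "Y \<in> G"
      have "X \<noteq> {}" using ne XY by blast
      from local_conj_block_map[OF _ G[OF XY(1)] G[OF XY(2)] this]
      show "(\<exists>r. \<exists>\<phi>\<in>?W r. \<exists>\<psi>\<in>?W r. local_conj r X Y (block_map r \<phi>) (block_map r \<psi>)) \<longleftrightarrow> conjugate A X Y"
        unfolding conjugate_iff_local_conj[OF A G[OF XY(1)] G[OF XY(2)]] by metis
    qed
    finally show "P \<in> (\<Union>r. \<Union>\<phi>\<in>?W r. \<Union>\<psi>\<in>?W r. ?C r \<phi> \<psi>) \<longleftrightarrow> P \<in> conjugacy_on A G"
      by (simp add: P conjugacy_on_def)
  qed
  ultimately show ?thesis by simp
qed

end

section \<open>The hyperfinite filtration\<close>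

text \<open>A finite alphabet leaves finitely many blocks of length \<open>q\<close>, so the kernel
  of \<open>w\<close> has finitely many classes. A point with this kernel is determined by its
  blocks at one index per class.\<close>

lemma finite_kernel:
  assumes A: "finite A" and q: "0 < q" and w: "w \<in> topspace (full_shift A)"
  shows "finite {y \<in> topspace (full_shift A). block_kernel q y = block_kernel q w}"
proof -
  define b where "b = (\<lambda>k. \<lambda>i\<in>{0..<int q}. w (i + k * int q))"
  have "range b \<subseteq> {0..<int q} \<rightarrow>\<^sub>E A" using w by (auto simp: b_def topspace_full_shift)
  then have "finite (range b)" by (rule finite_subset) (intro finite_PiE A, auto)
  \<comment> \<open>\<open>\<rho> k\<close> is the chosen index for the class of \<open>k\<close>;
    it depends only on the block \<open>b k\<close>.\<close>
  define \<rho> where "\<rho> = (\<lambda>k. inv b (b k))"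
  have fin\<rho>: "finite (range \<rho>)"
    using finite_imageI[OF \<open>finite (range b)\<close>, of "inv b"] by (simp add: \<rho>_def image_image)
  have b\<rho>: "b (\<rho> k) = b k" for k by (simp add: \<rho>_def f_inv_into_f)
  have \<rho>: "(k, \<rho> k) \<in> block_kernel q w" for k
    using fun_cong[OF b\<rho>[of k]] by (fastforce simp: block_kernel_def b_def split: if_splits)
  define D where "D = (\<lambda>(i, k). i + k * int q) ` ({0..<int q} \<times> range \<rho>)"
  have "finite D" unfolding D_def by (rule finite_imageI) (use fin\<rho> in simp)
  let ?S = "{y \<in> topspace (full_shift A). block_kernel q y = block_kernel q w}"
  have "inj_on (\<lambda>y. restrict y D) ?S"
  proof (rule inj_onI, rule ext)
    fix y y' j assume y: "y \<in> ?S" "y' \<in> ?S" and eq: "restrict y D = restrict y' D"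
    define i k where "i = j mod int q" and "k = j div int q"
    have j: "j = i + k * int q" and i: "i \<in> {0..<int q}" using q by (simp_all add: i_def k_def)
    have "(k, \<rho> k) \<in> block_kernel q y" "(k, \<rho> k) \<in> block_kernel q y'" using \<rho>[of k] y by simp_all
    then have "y j = y (i + \<rho> k * int q)" "y' j = y' (i + \<rho> k * int q)"
      using i by (auto simp: block_kernel_def j)
    moreover have "i + \<rho> k * int q \<in> D" using i by (auto simp: D_def)
    then have "y (i + \<rho> k * int q) = y' (i + \<rho> k * int q)"
      using fun_cong[OF eq, of "i + \<rho> k * int q"] by simp
    ultimately show "y j = y' j" by simp
  qed
  moreover have "(\<lambda>y. restrict y D) ` ?S \<subseteq> D \<rightarrow>\<^sub>E A" by (auto simp: topspace_full_shift)
  moreover have "finite (D \<rightarrow>\<^sub>E A)" by (intro finite_PiE A \<open>finite D\<close>)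
  ultimately show ?thesis by (meson finite_imageD finite_subset)
qed

text \<open>Each truncated condition looks at finitely many coordinates, so the solutions in
  \<open>Y\<close> form a decreasing sequence of nonempty closed sets.\<close>

lemma kernel_compactness:
  assumes A: "finite A" and Y: "subshift A Y"
    and ex: "\<And>N. \<exists>y\<in>Y. block_kernel q y \<inter> square N = \<kappa> \<inter> square N"
  shows "\<exists>y\<in>Y. block_kernel q y = \<kappa>"
proof -
  define C where "C = (\<lambda>N. Y \<inter> {y \<in> topspace (full_shift A). block_kernel q y \<inter> square N = \<kappa> \<inter> square N})"
  have "closedin (full_shift A) {y \<in> topspace (full_shift A). block_kernel q y \<inter> square N = \<kappa> \<inter> square N}" for N
    by (rule closedin_full_shift_local[of "q + N * q"]) (drule kernel_box_agree, simp)
  then have "closedin (full_shift A) (C N)" for N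
    unfolding C_def using Y by (intro closedin_Int) (auto simp: subshift_def)
  moreover have "C N \<noteq> {}" for N
    using ex[of N] subshift_subset[OF Y] by (auto simp: C_def)
  moreover have "decseq C"
  proof (rule decseq_SucI, rule subsetI)
    fix N y assume y: "y \<in> C (Suc N)"
    have "square N \<subseteq> square (Suc N)" by auto
    then show "y \<in> C N" using y unfolding C_def by blast
  qed
  ultimately have "(\<Inter>N. C N) \<noteq> {}"
    using compact_space_imp_nest[OF compact_space_full_shift[OF A]] by blast
  then obtain y where y: "\<And>N. y \<in> C N" by blast
  have "(k, l) \<in> block_kernel q y \<longleftrightarrow> (k, l) \<in> \<kappa>" for k l
  proof -
    define N where "N = nat (max \<bar>k\<bar> \<bar>l\<bar>)"
    have "(k, l) \<in> square N" unfolding N_def by auto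
    moreover have "block_kernel q y \<inter> square N = \<kappa> \<inter> square N" using y[of N] by (simp add: C_def)
    ultimately show ?thesis by blast
  qed
  then have "block_kernel q y = \<kappa>" by auto
  moreover have "y \<in> Y" using y[of 0] by (simp add: C_def)
  ultimately show ?thesis by blast
qed

text \<open>Truncation to \<open>square N\<close> leaves finitely many possible values for each
  \<open>s\<close> and \<open>N\<close>, so that equality of two such sets is a finite Boolean
  combination of hitting conditions.\<close>

definition kernels :: "(nat \<Rightarrow> nat) \<Rightarrow> nat \<Rightarrow> nat \<Rightarrow> (int \<Rightarrow> 'a) set \<Rightarrow> (int \<times> int) set set" where
  "kernels p s N X = (\<lambda>z. block_kernel (p s) z \<inter> square N) ` good (p s) (p (s + 1)) X"

text \<open>Larger \<open>n\<close> compares fewer levels, hence the relations increase.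
  \<open>max n 1\<close> respects the indexing of \<open>p\<close> from \<open>1\<close>.\<close>

definition level_rel :: "'a set \<Rightarrow> (nat \<Rightarrow> nat) \<Rightarrow> nat \<Rightarrow> ((int \<Rightarrow> 'a) set \<times> (int \<Rightarrow> 'a) set) set" where
  "level_rel A p n = {(X, Y) \<in> conjugacy_on A (oxtoby_subshifts A p).
     \<forall>s\<ge>max n 1. \<forall>N. kernels p s N X = kernels p s N Y}"

section \<open>Kernel sets under conjugacy\<close>

lemma oxtoby_subshiftsE:
  assumes "X \<in> oxtoby_subshifts A p"
  obtains x where "subshift A X" "x \<in> X" "generalized_oxtoby A p x" "X = orbit_closure A x"
    "x \<in> topspace (full_shift A)" "period_structure x p"
    "\<forall>s\<ge>1. oxtoby_step (p s) (p (s + 1)) x"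
proof -
  obtain x where X: "subshift A X" and x: "generalized_oxtoby A p x" "X = orbit_closure A x"
    using assms by (auto simp: oxtoby_subshifts_def)
  have xT: "x \<in> topspace (full_shift A)" and px: "period_structure x p"
    using x(1) by (auto simp: generalized_oxtoby_def toeplitz_def)
  have "\<exists>n. agree N x (translate n x)" for N
    by (intro exI[of _ 0]) (simp add: agree_def)
  then have "x \<in> X" unfolding x(2) by (intro orbit_closureI xT)
  moreover have "oxtoby_step (p s) (p (s + 1)) x" if "1 \<le> s" for s
    using x(1) that unfolding generalized_oxtoby_def oxtoby_step_def by blast
  ultimately show thesis using that X x xT px by blast
qed

lemma oxtoby_subshift_skeleton:
  assumes X: "X = orbit_closure A x" "x \<in> topspace (full_shift A)" "period_structure x p"
    and z: "z \<in> X" and s: "1 \<le> s"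
  shows "\<exists>j. skeleton (p s) z = skeleton (p s) (translate j x)"
  using skeleton_orbit_closure[OF X(3,2) _ s] z X(1) by blast

text \<open>The level \<open>T\<close> is one from which both Oxtoby points have periodic margins of
  width \<open>2 * r\<close>. It depends on the radius of the conjugacy, so agreement is only
  eventual and an increasing union over \<open>n\<close> is formed.\<close>

lemma kernels_eventually_subset:
  assumes X: "X \<in> oxtoby_subshifts A p" and Y: "Y \<in> oxtoby_subshifts A p"
    and fg: "local_conj r X Y f g"
  shows "\<exists>T\<ge>1. \<forall>s\<ge>T. \<forall>N. kernels p s N X \<subseteq> kernels p s N Y"
proof -
  obtain x where x: "subshift A X" "x \<in> X" "generalized_oxtoby A p x" "X = orbit_closure A x"
    "x \<in> topspace (full_shift A)" "period_structure x p"
    "\<forall>s\<ge>1. oxtoby_step (p s) (p (s + 1)) x" by (rule oxtoby_subshiftsE[OF X])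
  obtain y where y: "subshift A Y" "y \<in> Y" "generalized_oxtoby A p y" "Y = orbit_closure A y"
    "y \<in> topspace (full_shift A)" "period_structure y p"
    "\<forall>s\<ge>1. oxtoby_step (p s) (p (s + 1)) y" by (rule oxtoby_subshiftsE[OF Y])
  obtain T1 where T1: "T1 \<ge> 1" "\<And>s i. s \<ge> T1 \<Longrightarrow> \<bar>i\<bar> \<le> int (2 * r) \<Longrightarrow> i \<in> Per (p s) x"
    using period_structure_eventually[OF x(6), of "2 * r"] by blast
  obtain T2 where T2: "T2 \<ge> 1" "\<And>s i. s \<ge> T2 \<Longrightarrow> \<bar>i\<bar> \<le> int (2 * r) \<Longrightarrow> i \<in> Per (p s) y"
    using period_structure_eventually[OF y(6), of "2 * r"] by blast
  have ps: "period_seq p" using x(6) by (simp add: period_structure_def)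
  have "kernels p s N X \<subseteq> kernels p s N Y" if s: "s \<ge> max T1 T2" for s N
  proof
    have s1: "1 \<le> s" using s T1(1) by simp
    fix \<kappa> assume "\<kappa> \<in> kernels p s N X"
    then obtain w where w: "w \<in> good (p s) (p (s + 1)) X" "\<kappa> = block_kernel (p s) w \<inter> square N"
      by (auto simp: kernels_def)
    have "\<exists>v\<in>good (p s) (p (s + 1)) Y. block_kernel (p s) v = block_kernel (p s) w"
    proof (rule local_conj_good_kernel[OF _ _ fg _ _ x(7)[rule_format, OF s1] _ y(7)[rule_format, OF s1] _ _ _ w(1)])
      show "0 < p s" "p s dvd p (s + 1)" using ps s1 by (auto simp: period_seq_def)
      show "\<And>n z. z \<in> X \<Longrightarrow> translate n z \<in> X" by (rule subshift_translate[OF x(1)])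
      show "\<And>n z. z \<in> Y \<Longrightarrow> translate n z \<in> Y" by (rule subshift_translate[OF y(1)])
      show "i \<in> Per (p s) x" if "\<bar>i\<bar> \<le> 2 * int r" for i using s that by (intro T1) auto
      show "i \<in> Per (p s) y" if "\<bar>i\<bar> \<le> 2 * int r" for i using s that by (intro T2) auto
      show "\<exists>j. skeleton (p (s + 1)) z = skeleton (p (s + 1)) (translate j x)" if "z \<in> X" for z
        by (rule oxtoby_subshift_skeleton[OF x(4,5,6) that]) simp
      show "\<exists>j. skeleton (p (s + 1)) z = skeleton (p (s + 1)) (translate j y)" if "z \<in> Y" for z
        by (rule oxtoby_subshift_skeleton[OF y(4,5,6) that]) simp
    qed
    then obtain v where v: "v \<in> good (p s) (p (s + 1)) Y" "block_kernel (p s) v = block_kernel (p s) w" by blast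
    show "\<kappa> \<in> kernels p s N Y"
      unfolding kernels_def w(2) v(2)[symmetric] using v(1) by (rule imageI)
  qed
  then show ?thesis using T1(1) by (intro exI[of _ "max T1 T2"]) auto
qed

lemma conjugacy_eq_Union_level_rel:
  assumes A: "finite A"
  shows "conjugacy_on A (oxtoby_subshifts A p) = (\<Union>n. level_rel A p n)"
proof
  show "(\<Union>n. level_rel A p n) \<subseteq> conjugacy_on A (oxtoby_subshifts A p)"
    by (auto simp: level_rel_def)
  show "conjugacy_on A (oxtoby_subshifts A p) \<subseteq> (\<Union>n. level_rel A p n)"
  proof clarify
    fix X Y assume XY: "(X, Y) \<in> conjugacy_on A (oxtoby_subshifts A p)"
    then have G: "X \<in> oxtoby_subshifts A p" "Y \<in> oxtoby_subshifts A p" and "conjugate A X Y"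
      by (auto simp: conjugacy_on_def)
    then obtain r f g where fg: "local_conj r X Y f g"
      using conjugate_iff_local_conj[OF A, of X Y] by (auto simp: oxtoby_subshifts_def)
    obtain T1 where T1: "\<forall>s\<ge>T1. \<forall>N. kernels p s N X \<subseteq> kernels p s N Y"
      using kernels_eventually_subset[OF G fg] by blast
    obtain T2 where T2: "\<forall>s\<ge>T2. \<forall>N. kernels p s N Y \<subseteq> kernels p s N X"
      using kernels_eventually_subset[OF G(2,1) local_conj_sym[OF fg]] by blast
    have "kernels p s N X = kernels p s N Y" if "max T1 T2 \<le> s" for s N
      using T1 T2 that by (intro subset_antisym) simp_all
    then have "(X, Y) \<in> level_rel A p (max T1 T2)"
      using XY by (simp add: level_rel_def)
    then show "(X, Y) \<in> (\<Union>n. level_rel A p n)" by blast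
  qed
qed

text \<open>Otherwise \<open>x\<close> has holes at every level. Since \<open>x\<close> is
  admissible but not good, no hole is filled from level \<open>m\<close> on, so a hole of level
  \<open>m\<close> would persist forever, against the period structure.\<close>

lemma good_empty_periodic:
  assumes px: "period_structure x p" and m: "1 \<le> m"
    and ox: "\<And>s. m \<le> s \<Longrightarrow> oxtoby_step (p s) (p (s + 1)) x" and x: "x \<in> X"
    and empty: "\<And>s. m \<le> s \<Longrightarrow> good (p s) (p (s + 1)) X = {}"
  shows "\<exists>s\<ge>1. Per (p s) x = UNIV"
proof (rule ccontr)
  assume "\<not> ?thesis"
  then have holes: "\<exists>i. hole (p s) x i" if "s \<ge> 1" for s
    using that by (auto simp: hole_def)
  have step: "hole (p (s + 1)) x i" if "m \<le> s" "hole (p s) x i" for s i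
    using empty[OF that(1)] ox[OF that(1)] x that(2) holes[of "s + 1"]
    by (auto simp: good_def proper_step_def)
  obtain i where i: "hole (p m) x i" using holes[OF m] by blast
  have hole: "hole (p s) x i" if "m \<le> s" for s
    using that by (induction s rule: dec_induct) (use i step in auto)
  obtain T where "\<forall>s\<ge>T. \<forall>j. \<bar>j\<bar> \<le> int (nat \<bar>i\<bar>) \<longrightarrow> j \<in> Per (p s) x"
    using period_structure_eventually[OF px] by blast
  then have "i \<in> Per (p (max T m)) x" by simp
  then show False using hole[of "max T m"] by (simp add: hole_def)
qed

text \<open>All members \<open>Y\<close> of the class contain a point with one common kernel at a
  single level. By \<open>finite_kernel\<close> there are finitely many such points, and by
  minimality each is the generator of at most one \<open>Y\<close>.\<close>

lemma finite_level_rel_class: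
  assumes A: "finite A"
  shows "finite (level_rel A p n `` {X})"
proof (cases "X \<in> oxtoby_subshifts A p")
  case False
  then have "level_rel A p n `` {X} = {}" by (auto simp: level_rel_def conjugacy_on_def)
  then show ?thesis by simp
next
  case True
  obtain x where x: "subshift A X" "x \<in> X" "generalized_oxtoby A p x" "X = orbit_closure A x"
    "x \<in> topspace (full_shift A)" "period_structure x p"
    "\<forall>s\<ge>1. oxtoby_step (p s) (p (s + 1)) x" by (rule oxtoby_subshiftsE[OF True])
  have ps: "period_seq p" using x(6) by (simp add: period_structure_def)
  have sub: "subshift A Y" if "(X, Y) \<in> level_rel A p n" for Y
    using that by (auto simp: level_rel_def conjugacy_on_def oxtoby_subshifts_def)
  have "\<exists>s\<ge>1. \<exists>w\<in>X. \<forall>Y. (X, Y) \<in> level_rel A p n \<longrightarrow> (\<exists>y\<in>Y. block_kernel (p s) y = block_kernel (p s) w)"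
  proof (cases "\<exists>s\<ge>max n 1. good (p s) (p (s + 1)) X \<noteq> {}")
    case True
    then obtain s w where s: "s \<ge> max n 1" and w: "w \<in> good (p s) (p (s + 1)) X" by blast
    have "\<exists>y\<in>Y. block_kernel (p s) y = block_kernel (p s) w" if Y: "(X, Y) \<in> level_rel A p n" for Y
    proof (rule kernel_compactness[OF A sub[OF Y]])
      fix N
      have "block_kernel (p s) w \<inter> square N \<in> kernels p s N X" using w by (auto simp: kernels_def)
      also have "kernels p s N X = kernels p s N Y" using Y s by (auto simp: level_rel_def)
      finally show "\<exists>y\<in>Y. block_kernel (p s) y \<inter> square N = block_kernel (p s) w \<inter> square N"
        by (auto simp: kernels_def good_def)
    qed
    moreover have "1 \<le> s" "w \<in> X" using s w by (auto simp: good_def)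
    ultimately show ?thesis by blast
  next
    case False
    \<comment> \<open>In the periodic case the common kernel is \<open>UNIV\<close>: a local map
      sends \<open>x\<close> to a point with the same period.\<close>
    then obtain s where s: "s \<ge> 1" "Per (p s) x = UNIV"
      using good_empty_periodic[OF x(6), of "max n 1" X] x(2,7) by auto
    have ker: "block_kernel (p s) y = UNIV" if y: "Per (p s) y = UNIV" for y :: "int \<Rightarrow> 'a"
    proof -
      have "y (i + k * int (p s)) = y i" for i k using y by (intro Per_value) simp
      then show ?thesis by (auto simp: block_kernel_def)
    qed
    have "\<exists>y\<in>Y. block_kernel (p s) y = block_kernel (p s) x" if Y: "(X, Y) \<in> level_rel A p n" for Y
    proof -
      have "conjugate A X Y" using Y by (auto simp: level_rel_def conjugacy_on_def)
      then obtain r f g where fg: "local_conj r X Y f g"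
        using conjugate_iff_local_conj[OF A x(1) sub[OF Y]] by blast
      then have f: "local_map r X f" "f x \<in> Y" using x(2) by (auto simp: local_conj_def)
      have "i \<in> Per (p s) (f x)" for i
        using s(2) by (intro local_map_Per[OF f(1) x(2)]) simp
      then have "block_kernel (p s) (f x) = UNIV" by (intro ker) blast
      then show ?thesis using f(2) ker[OF s(2)] by auto
    qed
    then show ?thesis using s(1) x(2) by blast
  qed
  then obtain s w where s: "1 \<le> s" and w: "w \<in> X"
    and ex: "\<And>Y. (X, Y) \<in> level_rel A p n \<Longrightarrow> \<exists>y\<in>Y. block_kernel (p s) y = block_kernel (p s) w" by blast
  have "level_rel A p n `` {X} \<subseteq>
    orbit_closure A ` {y \<in> topspace (full_shift A). block_kernel (p s) y = block_kernel (p s) w}"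
  proof
    fix Y assume "Y \<in> level_rel A p n `` {X}"
    then have XY: "(X, Y) \<in> level_rel A p n" by simp
    then have "Y \<in> oxtoby_subshifts A p" by (auto simp: level_rel_def conjugacy_on_def)
    then obtain v where v: "generalized_oxtoby A p v" "Y = orbit_closure A v"
      by (auto simp: oxtoby_subshifts_def)
    obtain y where y: "y \<in> Y" "block_kernel (p s) y = block_kernel (p s) w" using ex[OF XY] by blast
    have "Y = orbit_closure A y" using orbit_closure_eq[OF sub[OF XY] v(2,1) y(1)] by simp
    moreover have "y \<in> topspace (full_shift A)" using y(1) subshift_subset[OF sub[OF XY]] by blast
    ultimately show "Y \<in> orbit_closure A ` {y \<in> topspace (full_shift A). block_kernel (p s) y = block_kernel (p s) w}"
      using y(2) by blast
  qed
  moreover have "0 < p s" using ps s by (simp add: period_seq_def)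
  then have "finite {y \<in> topspace (full_shift A). block_kernel (p s) y = block_kernel (p s) w}"
    using w subshift_subset[OF x(1)] by (intro finite_kernel[OF A]) auto
  ultimately show ?thesis using finite_subset by blast
qed

lemma level_rel_measurable:
  assumes A: "finite A" and ps: "period_seq p"
  defines "M \<equiv> subshift_borel A (oxtoby_subshifts A p)"
  shows "level_rel A p n \<in> sets (M \<Otimes>\<^sub>M M)"
proof -
  let ?G = "oxtoby_subshifts A p"
  have G: "\<And>X. X \<in> ?G \<Longrightarrow> subshift A X" by (auto simp: oxtoby_subshifts_def)
  have "{} \<notin> ?G" by (auto elim: oxtoby_subshiftsE)
  then have E: "conjugacy_on A ?G \<in> sets (M \<Otimes>\<^sub>M M)"
    unfolding M_def by (intro conjugacy_on_measurable A G)
  let ?S = "\<lambda>s N \<kappa>. {z \<in> topspace (full_shift A).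
    oxtoby_step (p s) (p (s + 1)) z \<and> proper_step (p s) (p (s + 1)) z \<and> block_kernel (p s) z \<inter> square N = \<kappa>}"
  have S: "fsigma_in (full_shift A) (?S (s + max n 1) N \<kappa>)" for s N \<kappa>
    using ps by (intro fsigma_pred_good) (auto simp: period_seq_def)
  \<comment> \<open>The shift \<open>s + max n 1\<close> runs through the levels to be compared.
    \<open>Pow (square N)\<close> is finite and contains every truncated kernel, so equality of
    kernel sets is tested value by value.\<close>
  let ?F = "{P \<in> space (M \<Otimes>\<^sub>M M). \<forall>s N. \<forall>\<kappa>\<in>Pow (square N).
    (fst P \<inter> ?S (s + max n 1) N \<kappa> \<noteq> {} \<longrightarrow> snd P \<inter> ?S (s + max n 1) N \<kappa> \<noteq> {}) \<and>
    (snd P \<inter> ?S (s + max n 1) N \<kappa> \<noteq> {} \<longrightarrow> fst P \<inter> ?S (s + max n 1) N \<kappa> \<noteq> {})}"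
  have "?F \<in> sets (M \<Otimes>\<^sub>M M)"
    unfolding M_def
    by (intro sets.sets_Collect_countable_All sets.sets_Collect_finite_All sets.sets_Collect_conj
        sets.sets_Collect_imp pair_hit_fst[OF A G] pair_hit_snd[OF A G] S) auto
  then have "conjugacy_on A ?G \<inter> ?F \<in> sets (M \<Otimes>\<^sub>M M)" using E by blast
  moreover have "conjugacy_on A ?G \<inter> ?F = level_rel A p n"
  proof (intro set_eqI)
    fix P :: "(int \<Rightarrow> 'a) set \<times> (int \<Rightarrow> 'a) set"
    obtain X Y where P: "P = (X, Y)" by force
    show "P \<in> conjugacy_on A ?G \<inter> ?F \<longleftrightarrow> P \<in> level_rel A p n"
    proof (cases "P \<in> conjugacy_on A ?G")
      case True
      then have XY: "X \<in> ?G" "Y \<in> ?G" by (auto simp: P conjugacy_on_def)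
      have hit: "\<kappa> \<in> kernels p s N Z \<longleftrightarrow> Z \<inter> ?S s N \<kappa> \<noteq> {}" if "Z \<in> ?G" for Z s N \<kappa>
        unfolding kernels_def by (rule good_kernel_hit[OF subshift_subset[OF G[OF that]]])
      have sp: "P \<in> space (M \<Otimes>\<^sub>M M)"
        using XY space_pair[OF A G] by (simp add: P M_def)
      have "P \<in> ?F \<longleftrightarrow> (\<forall>s N. \<forall>\<kappa>\<in>Pow (square N).
          \<kappa> \<in> kernels p (s + max n 1) N X \<longleftrightarrow> \<kappa> \<in> kernels p (s + max n 1) N Y)"
        using sp unfolding hit[OF XY(1)] hit[OF XY(2)] by (simp add: P) blast
      also have "\<dots> \<longleftrightarrow> (\<forall>s N. kernels p (s + max n 1) N X = kernels p (s + max n 1) N Y)"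
      proof -
        have "kernels p s N Z \<subseteq> Pow (square N)" for s N and Z :: "(int \<Rightarrow> 'a) set"
          by (auto simp: kernels_def)
        then have "(\<forall>\<kappa>\<in>Pow (square N). \<kappa> \<in> kernels p s N X \<longleftrightarrow> \<kappa> \<in> kernels p s N Y) \<longleftrightarrow>
            kernels p s N X = kernels p s N Y" for s N by blast
        then show ?thesis by simp
      qed
      also have "\<dots> \<longleftrightarrow> (\<forall>s\<ge>max n 1. \<forall>N. kernels p s N X = kernels p s N Y)"
        by (metis le_add2 le_add_diff_inverse2)
      finally show ?thesis using True by (simp add: level_rel_def P)
    next
      case False
      then show ?thesis by (auto simp: level_rel_def)
    qed
  qed
  ultimately show ?thesis by simp
qed

section \<open>Assembly of the filtration\<close>

lemma equiv_level_rel: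
  assumes A: "finite A"
  shows "equiv (oxtoby_subshifts A p) (level_rel A p n)"
proof -
  let ?G = "oxtoby_subshifts A p"
  have E: "equiv ?G (conjugacy_on A ?G)"
    by (intro equiv_conjugacy_on A) (auto simp: oxtoby_subshifts_def)
  show ?thesis
  proof (rule equivI)
    show "level_rel A p n \<subseteq> ?G \<times> ?G" by (auto simp: level_rel_def conjugacy_on_def)
    show "refl_on ?G (level_rel A p n)"
      using E by (auto simp: equiv_def refl_on_def level_rel_def)
    show "sym (level_rel A p n)"
      using E by (auto simp: equiv_def sym_def level_rel_def)
    show "trans (level_rel A p n)"
    proof (rule transI)
      fix X Y Z assume XYZ: "(X, Y) \<in> level_rel A p n" "(Y, Z) \<in> level_rel A p n"
      then have "(X, Z) \<in> conjugacy_on A ?G"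
        using E unfolding equiv_def level_rel_def by (blast dest: transD)
      then show "(X, Z) \<in> level_rel A p n" using XYZ by (simp add: level_rel_def)
    qed
  qed
qed

theorem theorem1p1:
  fixes A :: "'a set" and p :: "nat \<Rightarrow> nat"
  assumes "finite A"
    and "\<forall>t\<ge>1. 0 < p t"
    and "\<forall>t\<ge>1. p t < p (t + 1)"
    and "\<forall>t\<ge>1. p t dvd p (t + 1)"
  shows "hyperfinite (subshift_borel A (oxtoby_subshifts A p)) (conjugacy_on A (oxtoby_subshifts A p))"
proof -
  let ?G = "oxtoby_subshifts A p"
  let ?M = "subshift_borel A ?G"
  let ?E = "conjugacy_on A ?G"
  have ps: "period_seq p" using assms(2-4) by (simp add: period_seq_def)
  have G: "\<And>X. X \<in> ?G \<Longrightarrow> subshift A X" by (auto simp: oxtoby_subshifts_def)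
  have sp: "space ?M = ?G" by (rule space_subshift_borel[OF assms(1) G])
  have U: "?E = (\<Union>n. level_rel A p n)" by (rule conjugacy_eq_Union_level_rel[OF assms(1)])
  have meas: "level_rel A p n \<in> sets (?M \<Otimes>\<^sub>M ?M)" for n
    by (rule level_rel_measurable[OF assms(1) ps])
  have "finite_borel_equiv ?M (level_rel A p n)" for n
    unfolding finite_borel_equiv_def borel_equiv_def sp
    using equiv_level_rel[OF assms(1)] meas finite_level_rel_class[OF assms(1)]
    by (auto elim!: quotientE)
  moreover have "incseq (level_rel A p)"
    by (auto simp: incseq_def level_rel_def)
  moreover have "countable_borel_equiv ?M ?E"
    unfolding countable_borel_equiv_def borel_equiv_def sp
  proof (intro conjI ballI)
    show "equiv ?G ?E" by (rule equiv_conjugacy_on[OF assms(1) G])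
    show "?E \<in> sets (?M \<Otimes>\<^sub>M ?M)" unfolding U using meas by blast
    fix C assume "C \<in> ?G // ?E"
    then obtain X where "C = ?E `` {X}" by (auto elim: quotientE)
    then have "C = (\<Union>n. level_rel A p n `` {X})" unfolding U by blast
    then show "countable C"
      using finite_level_rel_class[OF assms(1)] by (simp add: countable_finite)
  qed
  ultimately show ?thesis unfolding hyperfinite_def using U by blast
qed

end
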